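(* Let $X$ be a quasi-Banach rearrangement invariant space on $\mathbb{R}$ with lower Boyd index $p_X$ and upper Boyd index $q_X$. Then: (i) for $0<p<\infty$ and $0<r<\infty$, the operator $H^{(p,r)}$ is bounded from $X$ to $X$ if and only if $p_X>p$; (ii) for $0<q\le\infty$ and $0<r<\infty$, the operator $H_{(q,r)}$ is bounded from $X$ to $X$ if and only if $q_X<q$; (iii) for $0<p<\infty$, the operator $H^{(p,\infty)}$ is bounded from $X$ to $X$ if $p_X>p$; (iv) for $0<q<\infty$, the operator $H_{(q,\infty)}$ is bounded from $X$ to $X$ if $q_X<q$. Here an operator $T$ is bounded from $X$ to $X$ if there is a constant $C$ with $\|Tf\|_X\le C\|f\|_X$ for all $f\in X$.
   Context: For a measurable $f$ on $\mathbb{R}$, the decreasing rearrangement is $f^*(s)=\sup\{t: \text{measure}\{|f|>t\}>s\}$ for $s>0$. A rearrangement invariant (r.i.) space $X$ on $\mathbb{R}$ is a set of measurable functions (modulo a.e. equality) with a complete quasi-norm $\|\cdot\|_X$ such that: (1) if $g^*\le f^*$ and $f\in X$ then $g\in X$ and $\|g\|_X\le\|f\|_X$; (2) every simple function with support of finite measure is in $X$; (3) either $f_n\searrow 0$ implies $\|f_n\|_X\searrow 0$, or $0\le f_n\nearrow f$ with $\sup_n\|f_n\|_X<\infty$ implies $f\in X$ and $\|f\|_X=\sup_n\|f_n\|_X$. For $0<a<\infty$ let $D_af(t)=f(at)$. The lower Boyd index is $p_X=\sup\{p:\exists c\ \forall a<1\ \forall f\in X,\ \|D_af\|_X\le c\,a^{-1/p}\|f\|_X\}$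 and the upper Boyd index is $q_X=\inf\{q:\exists c\ \forall a>1\ \forall f\in X,\ \|D_af\|_X\le c\,a^{-1/q}\|f\|_X\}$. The Hardy operators (functions of $t>0$, viewed as functions on $\mathbb{R}$ by any extension with the same rearrangement, e.g. zero for $t\le 0$) are: $H^{(p,r)}f(t)=t^{-1/p}\left(\int_0^t (f^*(s))^r\,d(s^{r/p})\right)^{1/r}$; for $q<\infty$, $H_{(q,r)}f(t)=t^{-1/q}\left(\int_t^\infty (f^*(s))^r\,d(s^{r/q})\right)^{1/r}$; $H^{(p,\infty)}f(t)=\sup_{0<s<t}(s/t)^{1/p}f^*(s)$; $H_{(q,\infty)}f(t)=\sup_{s>t}(s/t)^{1/q}f^*(s)$; $H_{(\infty,r)}f(t)=\left(\int_t^\infty \frac{f^*(s)^r}{s}\,ds\right)^{1/r}$; $H_{(\infty,\infty)}f(t)=f^*(t)$. *)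

theory Defs
  imports "HOL-Analysis.Analysis"
begin

text \<open>Functions on the real line are real valued and Lebesgue measurable.
  The decreasing rearrangement takes values in [0,\<infinity>] (type ennreal):
  f*(s) = sup { t : measure {|f| > t} > s }.  Restricting to t \<ge> 0 does not
  change the value (the empty supremum is 0 in ennreal).\<close>

definition drearr :: "(real \<Rightarrow> real) \<Rightarrow> real \<Rightarrow> ennreal" where
  "drearr f s = (SUP t \<in> {t::real. 0 \<le> t \<and> ennreal s < emeasure lebesgue {x. t < \<bar>f x\<bar>}}. ennreal t)"

text \<open>Real powers of extended nonnegative reals (used only with positive exponents).\<close>
definition enn_powr :: "ennreal \<Rightarrow> real \<Rightarrow> ennreal" where
  "enn_powr x a = (if x = top then top else ennreal (enn2real x powr a))"

definition ri_space :: "(real \<Rightarrow> real) set \<Rightarrow> ((real \<Rightarrow> real) \<Rightarrow> real) \<Rightarrow> bool" where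
  "ri_space X N \<longleftrightarrow>
     X \<subseteq> borel_measurable lebesgue
   \<comment> \<open>vector space\<close>
   \<and> (\<forall>f\<in>X. \<forall>g\<in>X. (\<lambda>x. f x + g x) \<in> X)
   \<and> (\<forall>f\<in>X. \<forall>c::real. (\<lambda>x. c * f x) \<in> X)
   \<comment> \<open>quasi-norm\<close>
   \<and> (\<forall>f\<in>X. 0 \<le> N f)
   \<and> (\<forall>f\<in>X. N f = 0 \<longleftrightarrow> (AE x in lebesgue. f x = 0))
   \<and> (\<forall>f\<in>X. \<forall>c::real. N (\<lambda>x. c * f x) = \<bar>c\<bar> * N f)
   \<and> (\<exists>K\<ge>1. \<forall>f\<in>X. \<forall>g\<in>X. N (\<lambda>x. f x + g x) \<le> K * (N f + N g))
   \<comment> \<open>completeness\<close>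
   \<and> (\<forall>u::nat \<Rightarrow> real \<Rightarrow> real. (\<forall>n. u n \<in> X) \<longrightarrow>
        (\<forall>e>0. \<exists>M. \<forall>m\<ge>M. \<forall>n\<ge>M. N (\<lambda>x. u m x - u n x) < e) \<longrightarrow>
        (\<exists>f\<in>X. (\<lambda>n. N (\<lambda>x. u n x - f x)) \<longlonglongrightarrow> 0))
   \<comment> \<open>(1) rearrangement invariance / lattice property\<close>
   \<and> (\<forall>f\<in>X. \<forall>g\<in>borel_measurable lebesgue.
        (\<forall>s>0. drearr g s \<le> drearr f s) \<longrightarrow> g \<in> X \<and> N g \<le> N f)
   \<comment> \<open>(2) simple functions with support of finite measure\<close>
   \<and> (\<forall>g\<in>borel_measurable lebesgue. finite (range g) \<longrightarrow>
        emeasure lebesgue {x. g x \<noteq> 0} < \<infinity> \<longrightarrow> g \<in> X)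
   \<comment> \<open>(3) order continuity or Fatou property\<close>
   \<and> ((\<forall>u::nat \<Rightarrow> real \<Rightarrow> real. (\<forall>n. u n \<in> X) \<longrightarrow> (\<forall>n x. 0 \<le> u (Suc n) x \<and> u (Suc n) x \<le> u n x)
          \<longrightarrow> (\<forall>x. (\<lambda>n. u n x) \<longlonglongrightarrow> 0) \<longrightarrow> (\<lambda>n. N (u n)) \<longlonglongrightarrow> 0)
      \<or> (\<forall>u::nat \<Rightarrow> real \<Rightarrow> real. \<forall>f. (\<forall>n. u n \<in> X) \<longrightarrow> (\<forall>n x. 0 \<le> u n x \<and> u n x \<le> u (Suc n) x)
          \<longrightarrow> (\<forall>x. (\<lambda>n. u n x) \<longlonglongrightarrow> f x) \<longrightarrow> bdd_above (range (\<lambda>n. N (u n)))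
          \<longrightarrow> f \<in> X \<and> N f = (SUP n. N (u n))))"

definition dil :: "real \<Rightarrow> (real \<Rightarrow> real) \<Rightarrow> real \<Rightarrow> real" where
  "dil a f = (\<lambda>t. f (a * t))"

text \<open>If D_a f is not in X its norm is regarded as infinite, so the estimate
  includes membership D_a f \<in> X.\<close>
definition lower_boyd :: "(real \<Rightarrow> real) set \<Rightarrow> ((real \<Rightarrow> real) \<Rightarrow> real) \<Rightarrow> ereal" where
  "lower_boyd X N = Sup {ereal p | p. 0 < p \<and> (\<exists>c. \<forall>a. 0 < a \<and> a < 1 \<longrightarrow>
      (\<forall>f\<in>X. dil a f \<in> X \<and> N (dil a f) \<le> c * a powr (-1/p) * N f))}"

definition upper_boyd :: "(real \<Rightarrow> real) set \<Rightarrow> ((real \<Rightarrow> real) \<Rightarrow> real) \<Rightarrow> ereal" where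
  "upper_boyd X N = Inf {ereal q | q. 0 < q \<and> (\<exists>c. \<forall>a. 1 < a \<longrightarrow>
      (\<forall>f\<in>X. dil a f \<in> X \<and> N (dil a f) \<le> c * a powr (-1/q) * N f))}"

text \<open>d(s^{r/p}) = (r/p) s^{r/p-1} ds.\<close>
definition H_up :: "real \<Rightarrow> real \<Rightarrow> (real \<Rightarrow> real) \<Rightarrow> real \<Rightarrow> ennreal" where
  "H_up p r f t = ennreal (t powr (-1/p)) *
     enn_powr (\<integral>\<^sup>+ s \<in> {0<..<t}. enn_powr (drearr f s) r * ennreal ((r/p) * s powr (r/p - 1)) \<partial>lborel) (1/r)"

definition H_low_fin :: "real \<Rightarrow> real \<Rightarrow> (real \<Rightarrow> real) \<Rightarrow> real \<Rightarrow> ennreal" where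
  "H_low_fin q r f t = ennreal (t powr (-1/q)) *
     enn_powr (\<integral>\<^sup>+ s \<in> {t<..}. enn_powr (drearr f s) r * ennreal ((r/q) * s powr (r/q - 1)) \<partial>lborel) (1/r)"

definition H_low_inf :: "real \<Rightarrow> (real \<Rightarrow> real) \<Rightarrow> real \<Rightarrow> ennreal" where
  "H_low_inf r f t = enn_powr (\<integral>\<^sup>+ s \<in> {t<..}. enn_powr (drearr f s) r * ennreal (1 / s) \<partial>lborel) (1/r)"

definition H_low :: "ereal \<Rightarrow> real \<Rightarrow> (real \<Rightarrow> real) \<Rightarrow> real \<Rightarrow> ennreal" where
  "H_low q r = (if q = \<infinity> then H_low_inf r else H_low_fin (real_of_ereal q) r)"

definition H_up_inf :: "real \<Rightarrow> (real \<Rightarrow> real) \<Rightarrow> real \<Rightarrow> ennreal" where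
  "H_up_inf p f t = (SUP s \<in> {0<..<t}. ennreal ((s/t) powr (1/p)) * drearr f s)"

definition H_low_sup :: "real \<Rightarrow> (real \<Rightarrow> real) \<Rightarrow> real \<Rightarrow> ennreal" where
  "H_low_sup q f t = (SUP s \<in> {t<..}. ennreal ((s/t) powr (1/q)) * drearr f s)"

definition as_fun :: "(real \<Rightarrow> ennreal) \<Rightarrow> real \<Rightarrow> real" where
  "as_fun g = (\<lambda>t. if 0 < t then enn2real (g t) else 0)"

definition bounded_on :: "(real \<Rightarrow> real) set \<Rightarrow> ((real \<Rightarrow> real) \<Rightarrow> real) \<Rightarrow>
    ((real \<Rightarrow> real) \<Rightarrow> real \<Rightarrow> ennreal) \<Rightarrow> bool" where
  "bounded_on X N T \<longleftrightarrow> (\<exists>C. \<forall>f\<in>X.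
      (\<forall>t>0. T f t \<noteq> top) \<and> as_fun (T f) \<in> X \<and> N (as_fun (T f)) \<le> C * N f)"

end

theory Submission
  imports Defs
begin

text \<open>All quantities depend on \<open>f\<close> only through \<open>f*\<close>, which is viewed as a function \<open>rearr f\<close>
  equimeasurable with \<open>f\<close>. If \<open>p < p\<^sub>X\<close>, then \<open>H\<^bsup>(p,\<infinity>)\<^esup>f(t)\<close> is at most a geometrically weighted
  sum of dilations \<open>f*(e\<^bsup>-bk\<^esup>t)\<close>, and for large \<open>b\<close> this sum converges in \<open>X\<close> despite the
  quasi-triangle constant. For \<open>r < \<infinity>\<close>, the operator \<open>H\<^bsup>(p,r)\<^esup>\<close> is dominated pointwise by
  \<open>H\<^bsup>(p',\<infinity>)\<^esup>\<close> with \<open>p < p' < p\<^sub>X\<close>. Conversely, applying \<open>H\<^bsup>(p,r)\<^esup>\<close> twice dominates a multiple of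
  \<open>(log (1/a))\<^bsup>1/r\<^esup> a\<^bsup>1/p\<^esup> f*(at)\<close>, so the norm of some \<open>D\<^sub>a\<close> is at most \<open>a\<^bsup>-1/p\<^esup>/2\<close>, and iterating
  this \<open>D\<^sub>a\<close> gives an index strictly larger than \<open>p\<close>. The lower operators are treated in the same
  way.\<close>

subsection \<open>Decreasing rearrangement\<close>

definition distr_fun :: "(real \<Rightarrow> real) \<Rightarrow> real \<Rightarrow> ennreal" where
  "distr_fun f t = emeasure lebesgue {x. t < \<bar>f x\<bar>}"

lemma drearr_alt: "drearr f s = (SUP t \<in> {t. 0 \<le> t \<and> ennreal s < distr_fun f t}. ennreal t)"
  by (simp add: drearr_def distr_fun_def)

lemma drearr_mono_distr:
  assumes "\<And>t. 0 \<le> t \<Longrightarrow> distr_fun g t \<le> distr_fun f t"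
  shows "drearr g s \<le> drearr f s"
  unfolding drearr_alt using assms by (intro SUP_subset_mono) (auto intro: less_le_trans)

lemma drearr_antimono: "s \<le> s' \<Longrightarrow> drearr f s' \<le> drearr f s"
  unfolding drearr_alt
  by (intro SUP_subset_mono) (auto intro: le_less_trans[OF ennreal_leI])

lemma sets_level: "f \<in> borel_measurable lebesgue \<Longrightarrow> {x. t < \<bar>f x\<bar>} \<in> sets lebesgue"
  for f :: "real \<Rightarrow> real"
proof -
  assume [measurable]: "f \<in> borel_measurable lebesgue"
  have "{x \<in> space lebesgue. t < \<bar>f x\<bar>} \<in> sets lebesgue" by measurable
  then show ?thesis by simp
qed

lemma distr_fun_mono_AE:
  assumes "f \<in> borel_measurable lebesgue" "AE x in lebesgue. \<bar>g x\<bar> \<le> \<bar>f x\<bar>"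
  shows "distr_fun g t \<le> distr_fun f t"
  unfolding distr_fun_def using assms(2)
  by (intro emeasure_mono_AE sets_level assms(1)) (auto elim!: eventually_mono)

lemma distr_fun_antimono:
  assumes "f \<in> borel_measurable lebesgue" "t \<le> t'"
  shows "distr_fun f t' \<le> distr_fun f t"
  unfolding distr_fun_def using assms(2) by (intro emeasure_mono sets_level assms(1)) auto

text \<open>Continuity of the measure from below: the level sets at heights
  \<open>t + 1 / Suc n\<close> increase to the level set at \<open>t\<close>.\<close>

lemma distr_fun_right_cont:
  assumes "f \<in> borel_measurable lebesgue" "ennreal s < distr_fun f t"
  shows "\<exists>t'>t. ennreal s < distr_fun f t'"
proof -
  let ?A = "\<lambda>n::nat. {x. t + 1 / real (Suc n) < \<bar>f x\<bar>}"
  have "(\<Union>n. ?A n) = {x. t < \<bar>f x\<bar>}"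
  proof (intro equalityI subsetI)
    fix x assume "x \<in> (\<Union>n. ?A n)"
    then obtain n where "t + 1 / real (Suc n) < \<bar>f x\<bar>" by auto
    moreover have "0 < 1 / real (Suc n)" by simp
    ultimately have "t < \<bar>f x\<bar>" by linarith
    then show "x \<in> {x. t < \<bar>f x\<bar>}" by simp
  next
    fix x assume "x \<in> {x. t < \<bar>f x\<bar>}"
    then obtain n where "inverse (real (Suc n)) < \<bar>f x\<bar> - t"
      using reals_Archimedean[of "\<bar>f x\<bar> - t"] by auto
    then show "x \<in> (\<Union>n. ?A n)" by (auto simp: inverse_eq_divide algebra_simps intro!: exI[of _ n])
  qed
  moreover have "(SUP n. emeasure lebesgue (?A n)) = emeasure lebesgue (\<Union>n. ?A n)"
  proof (rule SUP_emeasure_incseq)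
    show "range ?A \<subseteq> sets lebesgue" using sets_level[OF assms(1)] by blast
    show "incseq ?A"
    proof (intro incseq_SucI subsetI)
      fix n x assume "x \<in> ?A n"
      moreover have "1 / real (Suc (Suc n)) \<le> 1 / real (Suc n)" by (simp add: frac_le)
      ultimately show "x \<in> ?A (Suc n)" by (auto simp del: of_nat_Suc)
    qed
  qed
  ultimately have "ennreal s < (SUP n. emeasure lebesgue (?A n))"
    using assms(2) by (simp add: distr_fun_def)
  then obtain n where "ennreal s < emeasure lebesgue (?A n)" unfolding less_SUP_iff by blast
  then have "ennreal s < distr_fun f (t + 1 / real (Suc n))" by (simp only: distr_fun_def)
  moreover have "t < t + 1 / real (Suc n)" by simp
  ultimately show ?thesis by blast
qed

text \<open>\<open>drearr\<close> and \<open>distr_fun\<close> are generalized inverses of each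
  other. The direction from right to left needs right continuity, since the supremum must exceed
  \<open>t\<close> strictly.\<close>

lemma less_drearr_iff:
  assumes "f \<in> borel_measurable lebesgue" "0 \<le> t"
  shows "ennreal t < drearr f s \<longleftrightarrow> ennreal s < distr_fun f t"
proof
  assume "ennreal t < drearr f s"
  then obtain t' where "0 \<le> t'" "ennreal s < distr_fun f t'" "ennreal t < ennreal t'"
    unfolding drearr_alt less_SUP_iff by auto
  moreover from this have "t \<le> t'" using assms(2) by (auto simp: ennreal_less_iff)
  ultimately show "ennreal s < distr_fun f t"
    using distr_fun_antimono[OF assms(1)] less_le_trans by blast
next
  assume "ennreal s < distr_fun f t"
  then obtain t' where t': "t < t'" "ennreal s < distr_fun f t'"
    using distr_fun_right_cont[OF assms(1)] by blast
  have "ennreal t < ennreal t'" using t' assms(2) by (simp add: ennreal_less_iff)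
  also have "\<dots> \<le> drearr f s"
    unfolding drearr_alt using t' assms(2) by (intro SUP_upper) auto
  finally show "ennreal t < drearr f s" .
qed

section \<open>The rearrangement as an equimeasurable function on the half line\<close>

lemma emeasure_initial_segment: "emeasure lebesgue {x::real. 0 < x \<and> ennreal x < m} = m"
proof (cases m)
  case (real r)
  then have "{x::real. 0 < x \<and> ennreal x < m} = {0<..<r}" by (auto simp: ennreal_less_iff)
  then show ?thesis using real by simp
next
  case top
  have "of_nat n \<le> emeasure lebesgue {0::real<..}" for n
  proof -
    have "emeasure lebesgue {0::real<..<real n} \<le> emeasure lebesgue {0::real<..}"
      by (intro emeasure_mono) auto
    then show ?thesis by (simp add: ennreal_of_nat_eq_real_of_nat)
  qed
  then have "emeasure lebesgue {0::real<..} = top"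
    by (metis SUP_least ennreal_SUP_of_nat_eq_top top.extremum_uniqueI)
  moreover have "{x::real. 0 < x \<and> ennreal x < m} = {0<..}" using top by auto
  ultimately show ?thesis using top by simp
qed

text \<open>\<open>f*\<close> as a real function, zero for arguments \<open>\<le> 0\<close>. An
  infinite value would be sent to 0; for members of the space \<open>f*\<close> is finite at every
  positive argument.\<close>

definition rearr :: "(real \<Rightarrow> real) \<Rightarrow> real \<Rightarrow> real" where
  "rearr f = as_fun (drearr f)"

lemma as_fun_nonneg: "0 \<le> as_fun g t"
  by (simp add: as_fun_def)

lemma rearr_nonneg: "0 \<le> rearr f t"
  by (simp add: rearr_def as_fun_nonneg)

text \<open>By the inversion rule, the level set of \<open>f*\<close> at height \<open>t\<close> is
  the initial segment of the half line whose length is \<open>distr_fun f t\<close>.\<close>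

lemma distr_fun_rearr:
  assumes "f \<in> borel_measurable lebesgue" "\<And>s. 0 < s \<Longrightarrow> drearr f s \<noteq> top" "0 \<le> t"
  shows "distr_fun (rearr f) t = distr_fun f t"
proof -
  have "{x. t < \<bar>rearr f x\<bar>} = {x. 0 < x \<and> ennreal x < distr_fun f t}"
  proof (intro set_eqI)
    fix x
    show "x \<in> {x. t < \<bar>rearr f x\<bar>} \<longleftrightarrow> x \<in> {x. 0 < x \<and> ennreal x < distr_fun f t}"
    proof (cases "0 < x")
      case True
      then obtain r where "0 \<le> r" "drearr f x = ennreal r" using assms(2)[of x] by (cases "drearr f x") auto
      then show ?thesis using True less_drearr_iff[OF assms(1,3), of x] assms(3)
        by (simp add: rearr_def as_fun_def ennreal_less_iff)
    qed (use assms(3) in \<open>auto simp: rearr_def as_fun_def\<close>)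
  qed
  then show ?thesis unfolding distr_fun_def[of "rearr f"] using emeasure_initial_segment by simp
qed

text \<open>For \<open>t < c\<close> the level set contains \<open>(0, s')\<close>, whose measure
  exceeds \<open>s\<close>. The margin \<open>s < s'\<close> serves the strict inequality in the
  definition of \<open>drearr\<close>; \<open>g\<close> itself may be far from monotone.\<close>

lemma drearr_geI:
  assumes "g \<in> borel_measurable lebesgue" "0 \<le> s" "s < s'" "\<And>x. 0 < x \<Longrightarrow> x < s' \<Longrightarrow> c \<le> \<bar>g x\<bar>"
  shows "ennreal c \<le> drearr g s"
proof (rule dense_le)
  fix y assume y: "y < ennreal c"
  then obtain t where t: "y = ennreal t" "0 \<le> t" by (cases y) auto
  then have "t < c" using y ennreal_leI[of c t] by (auto simp: not_less[symmetric])
  have "ennreal s < ennreal s'" using assms by (simp add: ennreal_less_iff)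
  also have "\<dots> = emeasure lebesgue {0<..<s'}" using assms by simp
  also have "\<dots> \<le> distr_fun g t"
    unfolding distr_fun_def using assms(4) \<open>t < c\<close>
    by (intro emeasure_mono sets_level assms(1)) force
  finally show "y \<le> drearr g s"
    unfolding drearr_alt t(1) using t(2) by (intro SUP_upper) auto
qed

lemma as_fun_antimono_measurable:
  assumes "\<And>s t. 0 < s \<Longrightarrow> s \<le> t \<Longrightarrow> T t \<le> T s" "\<And>t. 0 < t \<Longrightarrow> T t \<noteq> top"
  shows "as_fun T \<in> borel_measurable borel"
proof -
  have "mono_on {0<..} (\<lambda>t. - enn2real (T t))"
    using assms by (intro mono_onI) (auto intro!: enn2real_mono simp: less_top)
  then have "(\<lambda>t. - enn2real (T t)) \<in> borel_measurable (restrict_space borel {0<..})"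
    by (rule borel_measurable_mono_on_fnc)
  then have "(\<lambda>t. - (- enn2real (T t))) \<in> borel_measurable (restrict_space borel {0<..})"
    by (rule borel_measurable_uminus)
  then have "(\<lambda>t. if t \<in> {0<..} then enn2real (T t) else 0) \<in> borel_measurable borel"
    by (subst measurable_If_restrict_space_iff) (auto simp: greaterThan_def)
  then show ?thesis by (simp add: as_fun_def)
qed

lemma lebesgue_measurable_dil:
  assumes "f \<in> borel_measurable lebesgue"
  shows "dil a f \<in> borel_measurable lebesgue"
  using measurable_comp[OF lebesgue_measurable_scaling[of a] assms]
  by (simp add: dil_def comp_def)

text \<open>The level sets of \<open>dil a f\<close> are those of \<open>f\<close> scaled by
  \<open>1 / a\<close>.\<close>

lemma distr_fun_dil:
  assumes "0 < a"
  shows "distr_fun (dil a f) t = ennreal (1 / a) * distr_fun f t"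
proof -
  have "{x. t < \<bar>f (a * x)\<bar>} = (\<lambda>x. (1 / a) *\<^sub>R x + 0) ` {x. t < \<bar>f x\<bar>}"
  proof (intro equalityI subsetI)
    fix x assume "x \<in> {x. t < \<bar>f (a * x)\<bar>}"
    then show "x \<in> (\<lambda>x. (1 / a) *\<^sub>R x + 0) ` {x. t < \<bar>f x\<bar>}"
      using assms by (intro image_eqI[of _ _ "a * x"]) auto
  qed (use assms in auto)
  then show ?thesis
    unfolding distr_fun_def dil_def using emeasure_lebesgue_affine[of "1 / a" 0 "{x. t < \<bar>f x\<bar>}"] assms
    by simp
qed

subsection \<open>Rearrangement invariant spaces\<close>

locale ri =
  fixes X :: "(real \<Rightarrow> real) set" and N :: "(real \<Rightarrow> real) \<Rightarrow> real"
  assumes ri: "ri_space X N"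
begin

lemma ri_properties:
  shows "X \<subseteq> borel_measurable lebesgue"
    "\<forall>f\<in>X. \<forall>g\<in>X. (\<lambda>x. f x + g x) \<in> X"
    "\<forall>f\<in>X. \<forall>c::real. (\<lambda>x. c * f x) \<in> X"
    "\<forall>f\<in>X. 0 \<le> N f"
    "\<forall>f\<in>X. N f = 0 \<longleftrightarrow> (AE x in lebesgue. f x = 0)"
    "\<forall>f\<in>X. \<forall>c::real. N (\<lambda>x. c * f x) = \<bar>c\<bar> * N f"
    "\<exists>K\<ge>1. \<forall>f\<in>X. \<forall>g\<in>X. N (\<lambda>x. f x + g x) \<le> K * (N f + N g)"
    "\<forall>u::nat \<Rightarrow> real \<Rightarrow> real. (\<forall>n. u n \<in> X) \<longrightarrow>
        (\<forall>e>0. \<exists>M. \<forall>m\<ge>M. \<forall>n\<ge>M. N (\<lambda>x. u m x - u n x) < e) \<longrightarrow>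
        (\<exists>f\<in>X. (\<lambda>n. N (\<lambda>x. u n x - f x)) \<longlonglongrightarrow> 0)"
    "\<forall>f\<in>X. \<forall>g\<in>borel_measurable lebesgue.
        (\<forall>s>0. drearr g s \<le> drearr f s) \<longrightarrow> g \<in> X \<and> N g \<le> N f"
    "\<forall>g\<in>borel_measurable lebesgue. finite (range g) \<longrightarrow>
        emeasure lebesgue {x. g x \<noteq> 0} < \<infinity> \<longrightarrow> g \<in> X"
  using ri unfolding ri_space_def by - (elim conjE, assumption)+

lemma X_measurable: "f \<in> X \<Longrightarrow> f \<in> borel_measurable lebesgue"
  using ri_properties(1) by blast

lemma X_add: "f \<in> X \<Longrightarrow> g \<in> X \<Longrightarrow> (\<lambda>x. f x + g x) \<in> X"
  using ri_properties(2) by blast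

lemma X_scale: "f \<in> X \<Longrightarrow> (\<lambda>x. c * f x) \<in> X"
  using ri_properties(3) by blast

lemma N_nonneg: "f \<in> X \<Longrightarrow> 0 \<le> N f"
  using ri_properties(4) by blast

lemma N_eq_0_iff: "f \<in> X \<Longrightarrow> N f = 0 \<longleftrightarrow> (AE x in lebesgue. f x = 0)"
  using ri_properties(5) by blast

lemma N_scale: "f \<in> X \<Longrightarrow> N (\<lambda>x. c * f x) = \<bar>c\<bar> * N f"
  using ri_properties(6) by blast

lemma drearr_dominated:
  assumes "f \<in> X" "g \<in> borel_measurable lebesgue" "\<And>s. 0 < s \<Longrightarrow> drearr g s \<le> drearr f s"
  shows "g \<in> X" "N g \<le> N f"
  using ri_properties(9) assms by blast+

lemma X_simple:
  "g \<in> borel_measurable lebesgue \<Longrightarrow> finite (range g) \<Longrightarrow> emeasure lebesgue {x. g x \<noteq> 0} < \<infinity> \<Longrightarrow> g \<in> X"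
  using ri_properties(10) by blast

lemma dominated_AE:
  assumes "f \<in> X" "g \<in> borel_measurable lebesgue" "AE x in lebesgue. \<bar>g x\<bar> \<le> \<bar>f x\<bar>"
  shows "g \<in> X" "N g \<le> N f"
  using drearr_dominated[OF assms(1,2)] drearr_mono_distr
    distr_fun_mono_AE[OF X_measurable[OF assms(1)] assms(3)] by blast+

lemma dominated:
  assumes "f \<in> X" "g \<in> borel_measurable lebesgue" "\<And>x. \<bar>g x\<bar> \<le> \<bar>f x\<bar>"
  shows "g \<in> X" "N g \<le> N f"
  using dominated_AE[OF assms(1,2)] assms(3) by auto

lemma distr_dominated:
  assumes "f \<in> X" "g \<in> borel_measurable lebesgue" "\<And>t. 0 \<le> t \<Longrightarrow> distr_fun g t \<le> distr_fun f t"
  shows "g \<in> X" "N g \<le> N f"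
  using drearr_dominated[OF assms(1,2)] drearr_mono_distr assms(3) by blast+

lemma X_indicator: "(indicator {0<..<s} :: real \<Rightarrow> real) \<in> X"
proof (rule X_simple)
  show "finite (range (indicator {0<..<s} :: real \<Rightarrow> real))"
    by (rule finite_subset[of _ "{0, 1}"]) (auto simp: indicator_def)
  have "{x. indicator {0<..<s} x \<noteq> (0::real)} = {0<..<s}" by (auto simp: indicator_def)
  then show "emeasure lebesgue {x. indicator {0<..<s} x \<noteq> (0::real)} < \<infinity>"
    by (cases "0 \<le> s") auto
qed (intro borel_measurable_indicator, simp)

lemma N_indicator_pos:
  assumes "0 < s"
  shows "0 < N (indicator {0<..<s})"
proof -
  have "\<not> (AE x in lebesgue. indicator {0<..<s} x = (0::real))"
  proof
    assume "AE x in lebesgue. indicator {0<..<s} x = (0::real)"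
    then have "AE x in lebesgue. x \<in> {0<..<s} \<longleftrightarrow> x \<in> {}"
      by (rule eventually_mono) (auto simp: indicator_def split: if_splits)
    then have "emeasure lebesgue {0<..<s} = emeasure lebesgue ({} :: real set)"
      by (intro emeasure_eq_AE) auto
    then show False using assms by simp
  qed
  then show ?thesis
    using N_eq_0_iff[OF X_indicator] N_nonneg[OF X_indicator, of s] by force
qed

text \<open>If \<open>f*(s) = \<infinity>\<close>, then every multiple of the indicator of \<open>(0,s)\<close> is dominated by \<open>f\<close>,
  which contradicts the homogeneity of the quasi-norm.\<close>

lemma drearr_finite:
  assumes "f \<in> X" "0 < s"
  shows "drearr f s \<noteq> top"
proof
  assume top: "drearr f s = top"
  let ?I = "indicator {0<..<s} :: real \<Rightarrow> real"
  have bound: "c * N ?I \<le> N f" if "0 \<le> c" for c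
  proof -
    have "drearr (\<lambda>x. c * ?I x) u \<le> drearr f u" if "0 < u" for u
    proof (cases "u \<le> s")
      case True
      then have "drearr f u = top" using drearr_antimono[OF True, of f] top by (simp add: top_unique)
      then show ?thesis by simp
    next
      case False
      \<comment> \<open>Beyond \<open>s\<close> the rearrangement of \<open>c * ?I\<close> vanishes,
        because its support has measure \<open>s < u\<close>.\<close>
      have "distr_fun (\<lambda>x. c * ?I x) t \<le> ennreal u" if "0 \<le> t" for t
      proof -
        have "distr_fun (\<lambda>x. c * ?I x) t \<le> emeasure lebesgue {0<..<s}"
          unfolding distr_fun_def using that by (intro emeasure_mono) (auto simp: indicator_def)
        then show ?thesis using assms(2) False order_trans ennreal_leI[of s u] by force
      qed
      then have *: "{t. 0 \<le> t \<and> ennreal u < distr_fun (\<lambda>x. c * ?I x) t} = {}"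
        by (auto simp: not_less[symmetric])
      show ?thesis unfolding drearr_alt[of "\<lambda>x. c * ?I x"] * by (simp add: bot_ennreal)
    qed
    then have "N (\<lambda>x. c * ?I x) \<le> N f"
      by (intro drearr_dominated[OF assms(1)] borel_measurable_times borel_measurable_const
          borel_measurable_indicator) simp_all
    then show ?thesis using N_scale[OF X_indicator] that by simp
  qed
  \<comment> \<open>With this multiple, \<open>bound\<close> would read
    \<open>N f + 1 \<le> N f\<close>.\<close>
  have "0 \<le> (N f + 1) / N ?I" using N_nonneg[OF assms(1)] N_nonneg[OF X_indicator] by simp
  from bound[OF this] show False using N_indicator_pos[OF assms(2)] by simp
qed

lemma drearr_eq_rearr: "f \<in> X \<Longrightarrow> 0 < s \<Longrightarrow> drearr f s = ennreal (rearr f s)"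
  using drearr_finite[of f s] by (simp add: rearr_def as_fun_def less_top)

lemma rearr_measurable: "f \<in> X \<Longrightarrow> rearr f \<in> borel_measurable borel"
  unfolding rearr_def
  by (intro as_fun_antimono_measurable drearr_antimono drearr_finite)

lemma rearr_antimono: "f \<in> X \<Longrightarrow> 0 < s \<Longrightarrow> s \<le> t \<Longrightarrow> rearr f t \<le> rearr f s"
  unfolding rearr_def as_fun_def
  using drearr_antimono[of s t f] drearr_finite[of f s] by (auto intro!: enn2real_mono simp: less_top)

lemma distr_rearr: "f \<in> X \<Longrightarrow> 0 \<le> t \<Longrightarrow> distr_fun (rearr f) t = distr_fun f t"
  by (intro distr_fun_rearr X_measurable drearr_finite)

lemma X_rearr:
  assumes "f \<in> X"
  shows "rearr f \<in> X" "N (rearr f) = N f"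
proof -
  have m: "rearr f \<in> borel_measurable lebesgue"
    using rearr_measurable[OF assms] by (simp add: measurable_completion)
  show X: "rearr f \<in> X" using distr_dominated[OF assms m] distr_rearr[OF assms] by auto
  show "N (rearr f) = N f"
    using distr_dominated(2)[OF assms m] distr_dominated(2)[OF X X_measurable[OF assms]]
      distr_rearr[OF assms] by force
qed

text \<open>The distribution function of \<open>dil b f\<close> is \<open>1 / b\<close> times that
  of \<open>f\<close>, hence it decreases in \<open>b\<close>. The case \<open>a = b\<close> serves
  to pass between \<open>f\<close> and \<open>rearr f\<close>; the case \<open>a < b\<close> fills
  the gaps between the powers of one dilation.\<close>

lemma dil_mono:
  assumes "f \<in> X" "0 < a" "a \<le> b" "dil a g \<in> X" "\<And>t. 0 \<le> t \<Longrightarrow> distr_fun f t \<le> distr_fun g t"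
  shows "dil b f \<in> X" "N (dil b f) \<le> N (dil a g)"
proof -
  have "distr_fun (dil b f) t \<le> distr_fun (dil a g) t" if "0 \<le> t" for t
    using assms that by (auto simp: distr_fun_dil intro!: mult_mono ennreal_leI frac_le)
  then show "dil b f \<in> X" "N (dil b f) \<le> N (dil a g)"
    using distr_dominated[OF assms(4) lebesgue_measurable_dil[OF X_measurable[OF assms(1)]]] by blast+
qed

section \<open>Positive series in the quasi-norm\<close>

lemma N_zero: "(\<lambda>x. 0) \<in> X" "N (\<lambda>x. 0) = 0"
proof -
  show "(\<lambda>x. 0) \<in> X" by (intro X_simple) auto
  then show "N (\<lambda>x. 0) = 0" by (subst N_eq_0_iff) auto
qed

lemma X_diff: "f \<in> X \<Longrightarrow> g \<in> X \<Longrightarrow> (\<lambda>x. f x - g x) \<in> X"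
  using X_add[OF _ X_scale[of g "-1"], of f] by simp

lemma X_sum: "finite A \<Longrightarrow> (\<And>k. k \<in> A \<Longrightarrow> g k \<in> X) \<Longrightarrow> (\<lambda>x. \<Sum>k\<in>A. g k x) \<in> X"
  by (induction A rule: finite_induct) (auto simp: N_zero intro!: X_add)

lemma N_minus_commute: "f \<in> X \<Longrightarrow> g \<in> X \<Longrightarrow> N (\<lambda>x. f x - g x) = N (\<lambda>x. g x - f x)"
  using N_scale[OF X_diff, of g f "-1"] by simp

text \<open>Norm convergence implies a.e. domination: \<open>c 1\<^sub>E\<close> with \<open>E = {u\<^sub>m > F + c}\<close> is dominated by
  \<open>u\<^sub>n - F\<close> for all \<open>n \<ge> m\<close>, so it has norm zero.\<close>

lemma incseq_le_limit_AE:
  assumes u: "\<And>n. u n \<in> X" "\<And>m n x. m \<le> n \<Longrightarrow> u m x \<le> u n x"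
    and F: "F \<in> X" "(\<lambda>n. N (\<lambda>x. u n x - F x)) \<longlonglongrightarrow> 0"
  shows "AE x in lebesgue. u m x \<le> F x"
proof -
  have [measurable]: "F \<in> borel_measurable lebesgue" "u m \<in> borel_measurable lebesgue"
    using F u X_measurable by auto
  have pos: "AE x in lebesgue. u m x \<le> F x + c" if "0 < c" for c
  proof -
    define E where "E = {x. u m x > F x + c}"
    define g where "g = (\<lambda>x. c * (indicator E x :: real))"
    have "{x \<in> space lebesgue. u m x > F x + c} \<in> sets lebesgue" by measurable
    then have [measurable]: "E \<in> sets lebesgue" by (simp add: E_def)
    have gm: "g \<in> borel_measurable lebesgue" unfolding g_def by measurable
    have dom: "\<bar>g x\<bar> \<le> \<bar>u n x - F x\<bar>" if "m \<le> n" for n x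
      using u(2)[OF that, of x] \<open>0 < c\<close> by (auto simp: g_def E_def indicator_def)
    have gX: "g \<in> X" using dominated(1)[OF X_diff[OF u(1) F(1)] gm dom] by blast
    have "N g \<le> 0"
    proof (rule LIMSEQ_le_const[OF F(2)])
      show "\<exists>k. \<forall>n\<ge>k. N g \<le> N (\<lambda>x. u n x - F x)"
        using dominated(2)[OF X_diff[OF u(1) F(1)] gm dom] by blast
    qed
    then have "N g = 0" using N_nonneg[OF gX] by simp
    then have "AE x in lebesgue. g x = 0" using N_eq_0_iff[OF gX] by simp
    then show ?thesis
      by (rule eventually_mono) (use that in \<open>auto simp: g_def E_def indicator_def split: if_splits\<close>)
  qed
  have "AE x in lebesgue. \<forall>k::nat. u m x \<le> F x + inverse (real (Suc k))"
    unfolding AE_all_countable using pos by simp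
  then show ?thesis
  proof eventually_elim
    case (elim x)
    show ?case
    proof (rule field_le_epsilon)
      fix e :: real assume "0 < e"
      then obtain k where "inverse (real (Suc k)) < e" using reals_Archimedean by blast
      then show "u m x \<le> F x + e" using elim[rule_format, of k] by linarith
    qed
  qed
qed

text \<open>Each term peeled off a block costs a factor \<open>K\<close>, which the ratio
  \<open>1 / (2 * K)\<close> absorbs with a factor 2 to spare. Hence the partial sums are Cauchy,
  and their limit \<open>F\<close> dominates them a.e. because they increase. Splitting
  \<open>F\<close> into a partial sum and a remainder costs the second factor
  \<open>K\<close>.\<close>

lemma geometric_series_dominated:
  assumes K: "1 \<le> K" "\<And>f g. f \<in> X \<Longrightarrow> g \<in> X \<Longrightarrow> N (\<lambda>x. f x + g x) \<le> K * (N f + N g)"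
    and g: "\<And>k. g k \<in> X" "\<And>k x. 0 \<le> g k x" "\<And>k. N (g k) \<le> B * (1 / (2 * K)) ^ k"
  shows "\<exists>F\<in>X. (\<forall>n. AE x in lebesgue. (\<Sum>k<n. g k x) \<le> F x) \<and> N F \<le> 2 * K\<^sup>2 * B"
proof -
  define u where "u = (\<lambda>n x. \<Sum>k<n. g k x)"
  have uX: "u n \<in> X" for n unfolding u_def using g by (intro X_sum) auto
  have mono: "u m x \<le> u n x" if "m \<le> n" for m n x
    unfolding u_def using that g by (intro sum_mono2) auto
  have block: "N (\<lambda>x. \<Sum>k=m..<m+n. g k x) \<le> 2 * K * B * (1 / (2 * K)) ^ m" for m n
  proof (induction n arbitrary: m)
    case 0
    have "0 \<le> B" using g(3)[of 0] N_nonneg[OF g(1), of 0] by simp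
    then show ?case using K(1) N_zero by simp
  next
    case (Suc n)
    have "(\<Sum>k=m..<m+Suc n. g k x) = g m x + (\<Sum>k=Suc m..<Suc m+n. g k x)" for x
      by (subst sum.atLeast_Suc_lessThan) auto
    then have "N (\<lambda>x. \<Sum>k=m..<m+Suc n. g k x) \<le> K * (N (g m) + N (\<lambda>x. \<Sum>k=Suc m..<Suc m+n. g k x))"
      using K(2)[OF g(1) X_sum[OF _ g(1)], of "{Suc m..<Suc m+n}" m] by (simp only: finite_atLeastLessThan)
    also have "\<dots> \<le> K * (B * (1 / (2 * K)) ^ m + 2 * K * B * (1 / (2 * K)) ^ Suc m)"
      using K(1) by (intro mult_left_mono add_mono g(3) Suc.IH) auto
    \<comment> \<open>Both summands equal \<open>K * B * (1 / (2 * K)) ^ m\<close>.\<close>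
    also have "\<dots> = 2 * K * B * (1 / (2 * K)) ^ m" using K(1) by (simp add: field_simps)
    finally show ?case .
  qed
  have diff: "N (\<lambda>x. u n x - u m x) \<le> 2 * K * B * (1 / (2 * K)) ^ m" if "m \<le> n" for m n
  proof -
    have "u n x - u m x = (\<Sum>k=m..<m+(n-m). g k x)" for x
      unfolding u_def using that sum_diff_nat_ivl[of 0 m n "\<lambda>k. g k x"] by (simp add: atLeast0LessThan)
    then show ?thesis using block[of m "n - m"] by simp
  qed
  have lim: "(\<lambda>m. 2 * K * B * (1 / (2 * K)) ^ m) \<longlonglongrightarrow> 0"
    using K(1) by (intro tendsto_mult_right_zero LIMSEQ_realpow_zero) auto
  have "\<exists>F\<in>X. (\<lambda>n. N (\<lambda>x. u n x - F x)) \<longlonglongrightarrow> 0"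
  proof (rule ri_properties(8)[rule_format, OF uX])
    fix e :: real assume "0 < e"
    then obtain M where M: "\<And>m. m \<ge> M \<Longrightarrow> 2 * K * B * (1 / (2 * K)) ^ m < e"
      using order_tendstoD(2)[OF lim] by (auto simp: eventually_sequentially)
    have "N (\<lambda>x. u m x - u n x) < e" if "m \<ge> M" "n \<ge> M" for m n
    proof (cases "n \<le> m")
      case True
      then show ?thesis using diff[OF True] M[OF that(2)] by simp
    next
      case False
      then show ?thesis using diff[of m n] M[OF that(1)] N_minus_commute[OF uX uX, of m n] by simp
    qed
    then show "\<exists>M. \<forall>m\<ge>M. \<forall>n\<ge>M. N (\<lambda>x. u m x - u n x) < e" by blast
  qed
  then obtain F where F: "F \<in> X" "(\<lambda>n. N (\<lambda>x. u n x - F x)) \<longlonglongrightarrow> 0" by blast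
  have "N F \<le> K * (2 * K * B + N (\<lambda>x. u n x - F x))" for n
  proof -
    have "N (\<lambda>x. u n x + (F x - u n x)) \<le> K * (N (u n) + N (\<lambda>x. F x - u n x))"
      by (intro K(2) uX X_diff F(1))
    also have "\<dots> \<le> K * (2 * K * B + N (\<lambda>x. u n x - F x))"
      using K(1) diff[of 0 n] N_minus_commute[OF uX F(1), of n]
      by (intro mult_left_mono add_mono) (auto simp: u_def)
    finally show ?thesis by simp
  qed
  moreover have "(\<lambda>n. K * (2 * K * B + N (\<lambda>x. u n x - F x))) \<longlonglongrightarrow> K * (2 * K * B + 0)"
    by (intro tendsto_intros F(2))
  ultimately have "N F \<le> K * (2 * K * B + 0)" by (intro LIMSEQ_le_const) auto
  then have "N F \<le> 2 * K\<^sup>2 * B" by (simp add: power2_eq_square algebra_simps)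
  moreover have "AE x in lebesgue. (\<Sum>k<n. g k x) \<le> F x" for n
    using incseq_le_limit_AE[OF uX mono F, of n] by (simp add: u_def)
  ultimately show ?thesis using F(1) by blast
qed

subsection \<open>Sufficiency: the supremum operators\<close>

lemma bounded_on_dominated:
  assumes "bounded_on X N T" "0 \<le> c"
    and "\<And>f t. f \<in> X \<Longrightarrow> 0 < t \<Longrightarrow> S f t \<le> ennreal c * T f t"
    and "\<And>f. f \<in> X \<Longrightarrow> as_fun (S f) \<in> borel_measurable lebesgue"
  shows "bounded_on X N S"
proof -
  obtain C where C: "\<And>f t. f \<in> X \<Longrightarrow> 0 < t \<Longrightarrow> T f t \<noteq> top" "\<And>f. f \<in> X \<Longrightarrow> as_fun (T f) \<in> X"
    "\<And>f. f \<in> X \<Longrightarrow> N (as_fun (T f)) \<le> C * N f"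
    using assms(1) unfolding bounded_on_def by blast
  have "(\<forall>t>0. S f t \<noteq> top) \<and> as_fun (S f) \<in> X \<and> N (as_fun (S f)) \<le> (c * C) * N f"
    if f: "f \<in> X" for f
  proof -
    have fin: "ennreal c * T f t < top" if "0 < t" for t
      using C(1)[OF f that] by (simp add: ennreal_mult_less_top less_top)
    have le: "\<bar>as_fun (S f) t\<bar> \<le> \<bar>c * as_fun (T f) t\<bar>" for t
      using enn2real_mono[OF assms(3)[OF f] fin] assms(2)
      by (auto simp: as_fun_def enn2real_mult)
    note * = dominated[OF X_scale[OF C(2)[OF f]] assms(4)[OF f] le]
    have "N (as_fun (S f)) \<le> c * N (as_fun (T f))"
      using *(2) N_scale[OF C(2)[OF f]] assms(2) by simp
    also have "\<dots> \<le> c * (C * N f)" using C(3)[OF f] assms(2) by (rule mult_left_mono)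
    finally have "N (as_fun (S f)) \<le> c * C * N f" by (simp add: mult_ac)
    moreover have "S f t \<noteq> top" if "0 < t" for t
      using assms(3)[OF f that] fin[OF that] by (auto simp: top_unique)
    ultimately show ?thesis using *(1) by blast
  qed
  then show ?thesis unfolding bounded_on_def by blast
qed

text \<open>The functions \<open>c k * f*(a k * t)\<close> have geometrically decaying quasi-norms,
  so one member \<open>F\<close> of the space dominates their sum, and with it \<open>T f\<close>,
  almost everywhere. Monotonicity of \<open>T f\<close> yields its measurability and its finiteness
  at every point.\<close>

lemma bounded_on_dilation_series:
  assumes K: "1 \<le> K" "\<And>f g. f \<in> X \<Longrightarrow> g \<in> X \<Longrightarrow> N (\<lambda>x. f x + g x) \<le> K * (N f + N g)"
    and ac: "\<And>k::nat. 0 < a k" "\<And>k. 0 \<le> c k"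
    and dil: "\<And>f k. f \<in> X \<Longrightarrow> dil (a k) f \<in> X"
      "\<And>f k. f \<in> X \<Longrightarrow> c k * N (dil (a k) f) \<le> A * N f * (1 / (2 * K)) ^ k"
    and T: "\<And>f t. f \<in> X \<Longrightarrow> 0 < t \<Longrightarrow> T f t \<le> (\<Sum>k. ennreal (c k) * drearr f (a k * t))"
      "\<And>f s t. f \<in> X \<Longrightarrow> 0 < s \<Longrightarrow> s \<le> t \<Longrightarrow> T f t \<le> T f s"
  shows "bounded_on X N T"
  unfolding bounded_on_def
proof (intro exI[of _ "2 * K\<^sup>2 * A"] ballI)
  fix f assume f: "f \<in> X"
  define g where "g = (\<lambda>k x. c k * dil (a k) (rearr f) x)"
  have gX: "g k \<in> X" for k unfolding g_def by (intro X_scale dil X_rearr f)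
  have g_nonneg: "0 \<le> g k x" for k x using ac by (simp add: g_def dil_def rearr_nonneg)
  have gN: "N (g k) \<le> (A * N f) * (1 / (2 * K)) ^ k" for k
    using dil(2)[OF X_rearr(1)[OF f]] N_scale[OF dil(1)[OF X_rearr(1)[OF f]]] ac(2)
    by (simp add: g_def X_rearr(2)[OF f])
  obtain F where F: "F \<in> X" "\<And>n. AE x in lebesgue. (\<Sum>k<n. g k x) \<le> F x"
    "N F \<le> 2 * K\<^sup>2 * (A * N f)"
    using geometric_series_dominated[OF K gX g_nonneg gN] by blast
  have "AE x in lebesgue. \<forall>n. (\<Sum>k<n. g k x) \<le> F x"
    using F(2) by (simp add: AE_all_countable)
  then have TF: "AE x in lebesgue. 0 < x \<longrightarrow> T f x \<le> ennreal (F x)"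
  proof (rule eventually_mono, intro impI)
    fix x :: real assume x: "\<forall>n. (\<Sum>k<n. g k x) \<le> F x" "0 < x"
    have "T f x \<le> (\<Sum>k. ennreal (c k) * drearr f (a k * x))" by (rule T(1)[OF f x(2)])
    also have "\<dots> = (\<Sum>k. ennreal (g k x))"
      using ac x(2) by (intro suminf_cong) (simp add: drearr_eq_rearr[OF f] g_def dil_def ennreal_mult rearr_nonneg)
    also have "\<dots> \<le> ennreal (F x)"
    proof (rule suminf_le_const[OF summableI])
      fix n
      have "(\<Sum>k<n. ennreal (g k x)) = ennreal (\<Sum>k<n. g k x)" by (intro sum_ennreal g_nonneg)
      then show "(\<Sum>k<n. ennreal (g k x)) \<le> ennreal (F x)" using x(1) by (simp add: ennreal_leI)
    qed
    finally show "T f x \<le> ennreal (F x)" .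
  qed
  \<comment> \<open>The bound by \<open>F\<close> holds only a.e.; but an infinite value at
    \<open>t\<close> would make \<open>T f\<close> infinite on all of \<open>(0, t)\<close>, a set
    of positive measure.\<close>
  have fin: "T f t \<noteq> top" if "0 < t" for t
  proof
    assume top: "T f t = top"
    have "AE x in lebesgue. x \<notin> {0<..<t}"
      using TF
    proof (rule eventually_mono)
      fix x assume x: "0 < x \<longrightarrow> T f x \<le> ennreal (F x)"
      show "x \<notin> {0<..<t}"
      proof
        assume "x \<in> {0<..<t}"
        then have "T f t \<le> ennreal (F x)" using T(2)[OF f, of x t] x by auto
        then show False using top by (simp add: top_unique)
      qed
    qed
    then have "AE x in lebesgue. x \<in> {0<..<t} \<longleftrightarrow> x \<in> {}" by simp
    then have "emeasure lebesgue {0<..<t} = emeasure lebesgue ({} :: real set)"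
      by (intro emeasure_eq_AE) auto
    then show False using that by simp
  qed
  have "as_fun (T f) \<in> borel_measurable borel"
    by (intro as_fun_antimono_measurable T(2)[OF f] fin)
  then have meas: "as_fun (T f) \<in> borel_measurable lebesgue" by (simp add: measurable_completion)
  have "AE x in lebesgue. \<bar>as_fun (T f) x\<bar> \<le> \<bar>F x\<bar>"
    using TF
  proof (rule eventually_mono)
    fix x assume "0 < x \<longrightarrow> T f x \<le> ennreal (F x)"
    then have "0 < x \<longrightarrow> enn2real (T f x) \<le> enn2real (ennreal (F x))" by (auto intro: enn2real_mono)
    then show "\<bar>as_fun (T f) x\<bar> \<le> \<bar>F x\<bar>" by (cases "0 \<le> F x") (auto simp: as_fun_def ennreal_neg)
  qed
  from dominated_AE[OF F(1) meas this] F(3) fin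
  show "(\<forall>t>0. T f t \<noteq> top) \<and> as_fun (T f) \<in> X \<and> N (as_fun (T f)) \<le> 2 * K\<^sup>2 * A * N f"
    by (auto simp: mult_ac)
qed

end

section \<open>Pointwise bounds for the supremum operators\<close>

lemma H_up_inf_antimono:
  assumes "0 < s" "s \<le> t"
  shows "H_up_inf p f t \<le> H_up_inf p f s"
  unfolding H_up_inf_def
proof (rule SUP_least)
  fix x assume x: "x \<in> {0<..<t}"
  \<comment> \<open>Moving \<open>x\<close> to \<open>x * s / t\<close> keeps the ratio to the
    endpoint and can only increase \<open>f*\<close>.\<close>
  have "ennreal ((x / t) powr (1 / p)) * drearr f x \<le>
      ennreal ((x * s / t / s) powr (1 / p)) * drearr f (x * s / t)"
    using assms x by (intro mult_mono drearr_antimono) (auto simp: field_simps)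
  also have "\<dots> \<le> (SUP x\<in>{0<..<s}. ennreal ((x / s) powr (1 / p)) * drearr f x)"
    using assms x by (intro SUP_upper) (auto simp: field_simps)
  finally show "ennreal ((x / t) powr (1 / p)) * drearr f x \<le>
      (SUP x\<in>{0<..<s}. ennreal ((x / s) powr (1 / p)) * drearr f x)" .
qed

lemma H_low_sup_antimono:
  assumes "0 < s" "s \<le> t" "0 < q"
  shows "H_low_sup q f t \<le> H_low_sup q f s"
  unfolding H_low_sup_def
proof (rule SUP_least)
  fix x assume x: "x \<in> {t<..}"
  have "ennreal ((x / t) powr (1 / q)) * drearr f x \<le> ennreal ((x / s) powr (1 / q)) * drearr f x"
    using assms x by (intro mult_mono ennreal_leI powr_mono2 frac_le) auto
  also have "\<dots> \<le> (SUP x\<in>{s<..}. ennreal ((x / s) powr (1 / q)) * drearr f x)"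
    using assms x by (intro SUP_upper) auto
  finally show "ennreal ((x / t) powr (1 / q)) * drearr f x \<le>
      (SUP x\<in>{s<..}. ennreal ((x / s) powr (1 / q)) * drearr f x)" .
qed

lemma term_le_suminf: "f k \<le> (\<Sum>k. f k)" for f :: "nat \<Rightarrow> ennreal"
  using sum_le_suminf[of f "{k}"] by simp

text \<open>The interval \<open>(0, t)\<close> is cut into bands with endpoints
  \<open>exp (- b * k) * t\<close>. On a band the weight is bounded by its value at the right end
  and \<open>f*\<close> by its value at the left end; the supremum over bands is at most the
  sum.\<close>

lemma H_up_inf_le_series:
  assumes "0 < p" "0 < b" "0 < t"
  shows "H_up_inf p f t \<le> (\<Sum>k. ennreal (exp (- b * real k / p)) * drearr f (exp (- b * real (Suc k)) * t))"
  unfolding H_up_inf_def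
proof (rule SUP_least)
  fix s assume "s \<in> {0<..<t}"
  then have s: "0 < s" "s < t" by auto
  \<comment> \<open>\<open>k\<close> is the index of the band containing \<open>s\<close>.\<close>
  define k where "k = nat \<lfloor>ln (t / s) / b\<rfloor>"
  have "0 \<le> ln (t / s) / b" using s assms by simp
  then have k: "real k \<le> ln (t / s) / b" "ln (t / s) / b < real (Suc k)"
    unfolding k_def by linarith+
  have "ln (s / t) = - ln (t / s)" using s assms by (simp add: ln_div)
  then have "(s / t) powr (1 / p) \<le> exp (- b * real k / p)"
    using k(1) s assms by (simp add: powr_def field_simps)
  moreover have "exp (- b * real (Suc k)) * t \<le> s"
  proof -
    have "exp (- b * real (Suc k)) \<le> exp (ln (s / t))"
      using k(2) \<open>ln (s / t) = _\<close> assms by (simp add: field_simps)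
    then show ?thesis using s assms by (simp add: field_simps)
  qed
  ultimately have "ennreal ((s / t) powr (1 / p)) * drearr f s
      \<le> ennreal (exp (- b * real k / p)) * drearr f (exp (- b * real (Suc k)) * t)"
    by (intro mult_mono ennreal_leI drearr_antimono) auto
  also have "\<dots> \<le> (\<Sum>k. ennreal (exp (- b * real k / p)) * drearr f (exp (- b * real (Suc k)) * t))"
    by (rule term_le_suminf)
  finally show "ennreal ((s / t) powr (1 / p)) * drearr f s \<le> \<dots>" .
qed

text \<open>Here the bands run upwards from \<open>t\<close>, so the right end, which bounds the
  weight, carries \<open>Suc k\<close>, and the left end, which bounds \<open>f*\<close>, carries
  \<open>k\<close>.\<close>

lemma H_low_sup_le_series:
  assumes "0 < q" "0 < b" "0 < t"
  shows "H_low_sup q f t \<le> (\<Sum>k. ennreal (exp (b * real (Suc k) / q)) * drearr f (exp (b * real k) * t))"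
  unfolding H_low_sup_def
proof (rule SUP_least)
  fix s assume "s \<in> {t<..}"
  then have s: "0 < s" "t < s" using assms by auto
  define k where "k = nat \<lfloor>ln (s / t) / b\<rfloor>"
  have "0 \<le> ln (s / t) / b" using s assms by simp
  then have k: "real k \<le> ln (s / t) / b" "ln (s / t) / b < real (Suc k)"
    unfolding k_def by linarith+
  have "(s / t) powr (1 / q) \<le> exp (b * real (Suc k) / q)"
    using k(2) s assms by (simp add: powr_def field_simps)
  moreover have "exp (b * real k) * t \<le> s"
  proof -
    have "exp (b * real k) \<le> exp (ln (s / t))"
      using k(1) assms by (simp add: field_simps)
    then show ?thesis using s assms by (simp add: field_simps)
  qed
  ultimately have "ennreal ((s / t) powr (1 / q)) * drearr f s
      \<le> ennreal (exp (b * real (Suc k) / q)) * drearr f (exp (b * real k) * t)"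
    by (intro mult_mono ennreal_leI drearr_antimono) auto
  also have "\<dots> \<le> (\<Sum>k. ennreal (exp (b * real (Suc k) / q)) * drearr f (exp (b * real k) * t))"
    by (rule term_le_suminf)
  finally show "ennreal ((s / t) powr (1 / q)) * drearr f s \<le> \<dots>" .
qed

section \<open>From the Boyd indices to the supremum operators\<close>

context ri
begin

lemma less_lower_boydD:
  assumes "ereal p < lower_boyd X N" "0 < p"
  obtains p' c where "p < p'" "0 \<le> c" "\<And>a f. 0 < a \<Longrightarrow> a < 1 \<Longrightarrow> f \<in> X \<Longrightarrow> dil a f \<in> X"
    "\<And>a f. 0 < a \<Longrightarrow> a < 1 \<Longrightarrow> f \<in> X \<Longrightarrow> N (dil a f) \<le> c * a powr (- 1 / p') * N f"
proof -
  obtain x where "x \<in> {ereal p | p. 0 < p \<and> (\<exists>c. \<forall>a. 0 < a \<and> a < 1 \<longrightarrow>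
      (\<forall>f\<in>X. dil a f \<in> X \<and> N (dil a f) \<le> c * a powr (-1/p) * N f))}" "ereal p < x"
    using assms(1) unfolding lower_boyd_def less_Sup_iff by blast
  then obtain p' c where pc: "ereal p < ereal p'" "\<forall>a. 0 < a \<and> a < 1 \<longrightarrow>
      (\<forall>f\<in>X. dil a f \<in> X \<and> N (dil a f) \<le> c * a powr (-1/p') * N f)"
    by blast
  show ?thesis
  proof (rule that[of p' "max 0 c"])
    fix a :: real and f assume af: "0 < a" "a < 1" "f \<in> X"
    then have "N (dil a f) \<le> c * (a powr (- 1 / p') * N f)" using pc(2) by (auto simp: mult_ac)
    also have "\<dots> \<le> max 0 c * (a powr (- 1 / p') * N f)"
      using N_nonneg[OF af(3)] by (intro mult_right_mono) auto
    finally show "N (dil a f) \<le> max 0 c * a powr (- 1 / p') * N f" by (simp add: mult_ac)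
  qed (use pc in auto)
qed

text \<open>The constant is raised to at least 1 so that the estimate extends to
  \<open>a = 1\<close>, where the dilation is the identity.\<close>

lemma upper_boyd_lessD:
  assumes "upper_boyd X N < q"
  obtains q' c where "ereal q' < q" "0 < q'" "1 \<le> c" "\<And>a f. 1 < a \<Longrightarrow> f \<in> X \<Longrightarrow> dil a f \<in> X"
    "\<And>a f. 1 < a \<Longrightarrow> f \<in> X \<Longrightarrow> N (dil a f) \<le> c * a powr (- 1 / q') * N f"
proof -
  obtain x where "x \<in> {ereal q | q. 0 < q \<and> (\<exists>c. \<forall>a. 1 < a \<longrightarrow>
      (\<forall>f\<in>X. dil a f \<in> X \<and> N (dil a f) \<le> c * a powr (-1/q) * N f))}" "x < q"
    using assms(1) unfolding upper_boyd_def Inf_less_iff by blast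
  then obtain q' c where pc: "ereal q' < q" "0 < q'" "\<forall>a. 1 < a \<longrightarrow>
      (\<forall>f\<in>X. dil a f \<in> X \<and> N (dil a f) \<le> c * a powr (-1/q') * N f)"
    by blast
  show ?thesis
  proof (rule that[of q' "max 1 c"])
    fix a :: real and f assume af: "1 < a" "f \<in> X"
    then have "N (dil a f) \<le> c * (a powr (- 1 / q') * N f)" using pc(3) by (auto simp: mult_ac)
    also have "\<dots> \<le> max 1 c * (a powr (- 1 / q') * N f)"
      using N_nonneg[OF af(2)] by (intro mult_right_mono) auto
    finally show "N (dil a f) \<le> max 1 c * a powr (- 1 / q') * N f" by (simp add: mult_ac)
  qed (use pc in auto)
qed

text \<open>The ratio of the dilations is chosen so large that the geometric decay beats the constant
  \<open>K\<close> of the quasi-triangle inequality.\<close>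

lemma bounded_on_H_up_inf:
  assumes "0 < p" "ereal p < lower_boyd X N"
  shows "bounded_on X N (H_up_inf p)"
proof -
  obtain p' c where p': "p < p'" "0 \<le> c" "\<And>a f. 0 < a \<Longrightarrow> a < 1 \<Longrightarrow> f \<in> X \<Longrightarrow> dil a f \<in> X"
    "\<And>a f. 0 < a \<Longrightarrow> a < 1 \<Longrightarrow> f \<in> X \<Longrightarrow> N (dil a f) \<le> c * a powr (- 1 / p') * N f"
    using less_lower_boydD[OF assms(2,1)] by metis
  obtain K where K: "1 \<le> K" "\<And>f g. f \<in> X \<Longrightarrow> g \<in> X \<Longrightarrow> N (\<lambda>x. f x + g x) \<le> K * (N f + N g)"
    using ri_properties(7) by blast
  define d where "d = 1 / p - 1 / p'"
  have d: "0 < d" using p' assms by (simp add: d_def frac_less2)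
  \<comment> \<open>This \<open>b\<close> solves \<open>exp (- (b * d)) = 1 / (2 * K)\<close>, the
    ratio that the series bound asks for.\<close>
  define b where "b = ln (2 * K) / d"
  have b: "0 < b" using K(1) d by (simp add: b_def)
  show ?thesis
  proof (rule bounded_on_dilation_series[OF K, of "\<lambda>k. exp (- b * real (Suc k))" "\<lambda>k. exp (- b * real k / p)" "c * exp (b / p')"])
    fix f k assume f: "f \<in> X"
    have a: "exp (- b * real (Suc k)) < 1" using b by simp
    have "exp (- b * real k / p) * N (dil (exp (- b * real (Suc k))) f)
       \<le> exp (- b * real k / p) * (c * exp (- b * real (Suc k)) powr (- 1 / p') * N f)"
      using p'(4)[OF _ a f] by (intro mult_left_mono) auto
    also have "\<dots> = c * N f * (exp (- b * real k / p) * exp (b * real (Suc k) / p'))"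
      by (simp add: powr_def)
    \<comment> \<open>The shift between the index of the weight and that of the dilation leaves the
      constant factor \<open>exp (b / p')\<close>.\<close>
    also have "exp (- b * real k / p) * exp (b * real (Suc k) / p') = exp (b / p') * exp (- (b * d)) ^ k"
      by (simp add: exp_of_nat_mult[symmetric] exp_add[symmetric] d_def algebra_simps add_divide_distrib)
    also have "exp (- (b * d)) = 1 / (2 * K)"
      using K(1) d by (simp add: b_def exp_minus inverse_eq_divide)
    finally show "exp (- b * real k / p) * N (dil (exp (- b * real (Suc k))) f)
        \<le> c * exp (b / p') * N f * (1 / (2 * K)) ^ k" by (simp add: mult_ac)
    show "dil (exp (- b * real (Suc k))) f \<in> X" using p'(3)[OF _ a f] by simp
  qed (use H_up_inf_le_series[OF assms(1) b] H_up_inf_antimono in auto)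
qed

text \<open>The weights now grow like \<open>exp (b * k / q)\<close> while the dilations decay like
  \<open>exp (- b * k / q')\<close>; since \<open>q' < q\<close> the product decays, and
  \<open>b\<close> is again fixed by the ratio \<open>1 / (2 * K)\<close>.\<close>

lemma bounded_on_H_low_sup:
  assumes "0 < q" "upper_boyd X N < ereal q"
  shows "bounded_on X N (H_low_sup q)"
proof -
  obtain q' c where q': "q' < q" "0 < q'" "1 \<le> c" "\<And>a f. 1 < a \<Longrightarrow> f \<in> X \<Longrightarrow> dil a f \<in> X"
    "\<And>a f. 1 < a \<Longrightarrow> f \<in> X \<Longrightarrow> N (dil a f) \<le> c * a powr (- 1 / q') * N f"
    using upper_boyd_lessD[OF assms(2)] by (metis ereal_less(2) ereal_less_eq(3) less_ereal.simps(1))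
  obtain K where K: "1 \<le> K" "\<And>f g. f \<in> X \<Longrightarrow> g \<in> X \<Longrightarrow> N (\<lambda>x. f x + g x) \<le> K * (N f + N g)"
    using ri_properties(7) by blast
  define d where "d = 1 / q' - 1 / q"
  have d: "0 < d" using q' assms by (simp add: d_def frac_less2)
  define b where "b = ln (2 * K) / d"
  have b: "0 < b" using K(1) d by (simp add: b_def)
  show ?thesis
  proof (rule bounded_on_dilation_series[OF K, of "\<lambda>k. exp (b * real k)" "\<lambda>k. exp (b * real (Suc k) / q)" "c * exp (b / q)"])
    fix f k assume f: "f \<in> X"
    have D: "dil (exp (b * real k)) f \<in> X \<and>
      N (dil (exp (b * real k)) f) \<le> c * exp (b * real k) powr (- 1 / q') * N f"
    \<comment> \<open>The first dilation is the identity, outside the range \<open>1 < a\<close> of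
      the Boyd estimate; here \<open>1 \<le> c\<close> is used.\<close>
    proof (cases "k = 0")
      case True
      then show ?thesis using f q'(3) N_nonneg[OF f] mult_right_mono[of 1 c "N f"] by (simp add: dil_def)
    qed (use q'(4,5)[OF _ f, of "exp (b * real k)"] b in auto)
    have "exp (b * real (Suc k) / q) * N (dil (exp (b * real k)) f)
       \<le> exp (b * real (Suc k) / q) * (c * exp (b * real k) powr (- 1 / q') * N f)"
      using D by (intro mult_left_mono) auto
    also have "\<dots> = c * N f * (exp (b * real (Suc k) / q) * exp (- b * real k / q'))"
      by (simp add: powr_def)
    also have "exp (b * real (Suc k) / q) * exp (- b * real k / q') = exp (b / q) * exp (- (b * d)) ^ k"
      by (simp add: exp_of_nat_mult[symmetric] exp_add[symmetric] d_def algebra_simps add_divide_distrib)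
    also have "exp (- (b * d)) = 1 / (2 * K)"
      using K(1) d by (simp add: b_def exp_minus inverse_eq_divide)
    finally show "exp (b * real (Suc k) / q) * N (dil (exp (b * real k)) f)
        \<le> c * exp (b / q) * N f * (1 / (2 * K)) ^ k" by (simp add: mult_ac)
    show "dil (exp (b * real k)) f \<in> X" using D by simp
  qed (use H_low_sup_le_series[OF assms(1) b] H_low_sup_antimono assms(1) in auto)
qed

end

subsection \<open>Sufficiency: finite exponents\<close>

lemma enn_powr_mono: "0 \<le> a \<Longrightarrow> x \<le> y \<Longrightarrow> enn_powr x a \<le> enn_powr y a"
  unfolding enn_powr_def
  by (auto simp: top_unique less_top intro!: ennreal_leI powr_mono2 enn2real_mono)

lemma enn_powr_ennreal: "0 \<le> x \<Longrightarrow> enn_powr (ennreal x) a = ennreal (x powr a)"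
  by (simp add: enn_powr_def)

text \<open>All Hardy operators with finite \<open>r\<close> in one form, with \<open>d = 1/p\<close> resp. \<open>d = 1/q\<close>;
  the case \<open>q = \<infinity>\<close> is \<open>d = 0\<close>, \<open>b = 1\<close>.\<close>

definition hardy :: "real set \<Rightarrow> real \<Rightarrow> real \<Rightarrow> real \<Rightarrow> (real \<Rightarrow> real) \<Rightarrow> real \<Rightarrow> ennreal" where
  "hardy B b d r f t = ennreal (t powr (- d)) *
     enn_powr (\<integral>\<^sup>+ s \<in> B. enn_powr (drearr f s) r * ennreal (b * s powr (r * d - 1)) \<partial>lborel) (1 / r)"

lemma H_up_eq_hardy: "H_up p r f t = hardy {0<..<t} (r / p) (1 / p) r f t"
  by (simp add: H_up_def hardy_def)

lemma H_low_fin_eq_hardy: "H_low_fin q r f t = hardy {t<..} (r / q) (1 / q) r f t"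
  by (simp add: H_low_fin_def hardy_def)

text \<open>At \<open>t = 0\<close> the factor \<open>t powr 0\<close> would be 0 rather than 1,
  hence the restriction to positive \<open>t\<close>.\<close>

lemma H_low_inf_eq_hardy: "0 < t \<Longrightarrow> H_low_inf r f t = hardy {t<..} 1 0 r f t"
  unfolding H_low_inf_def hardy_def
  by (auto intro!: arg_cong2[where f = enn_powr] nn_integral_cong
      simp: indicator_def powr_minus inverse_eq_divide)

text \<open>Under the power bound on \<open>f*\<close> the integrand is at most a constant times a
  pure power of \<open>s\<close>, and after integration all powers of \<open>t\<close> cancel. In
  the applications \<open>m\<close> is the value at \<open>t\<close> of a supremum operator with
  exponent \<open>d'\<close>.\<close>

lemma hardy_upper:
  assumes "0 < r" "0 < t" "0 \<le> m" "0 \<le> b" "0 \<le> k" "B \<subseteq> {0<..}"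
    and [measurable]: "B \<in> sets borel"
    and "\<And>s. s \<in> B \<Longrightarrow> drearr f s \<le> ennreal (m * (t / s) powr d')"
    and "(\<integral>\<^sup>+ s \<in> B. ennreal (s powr (r * (d - d') - 1)) \<partial>lborel) \<le> ennreal (k * t powr (r * (d - d')))"
  shows "hardy B b d r f t \<le> ennreal ((b * k) powr (1 / r)) * ennreal m"
proof -
  \<comment> \<open>\<open>c\<close> collects the factors that do not depend on
    \<open>s\<close>.\<close>
  define c where "c = (m * t powr d') powr r * b"
  have c: "0 \<le> c" using assms by (simp add: c_def)
  have "(\<integral>\<^sup>+ s \<in> B. enn_powr (drearr f s) r * ennreal (b * s powr (r * d - 1)) \<partial>lborel)
    \<le> (\<integral>\<^sup>+ s. ennreal c * (ennreal (s powr (r * (d - d') - 1)) * indicator B s) \<partial>lborel)"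
  proof (rule nn_integral_mono)
    fix s
    show "enn_powr (drearr f s) r * ennreal (b * s powr (r * d - 1)) * indicator B s
      \<le> ennreal c * (ennreal (s powr (r * (d - d') - 1)) * indicator B s)"
    proof (cases "s \<in> B")
      case True
      then have s: "0 < s" using assms by auto
      have "enn_powr (drearr f s) r \<le> enn_powr (ennreal (m * (t / s) powr d')) r"
        using assms(1) assms(8)[OF True] by (intro enn_powr_mono) auto
      also have "\<dots> = ennreal ((m * (t / s) powr d') powr r)"
        using assms(3) by (intro enn_powr_ennreal) auto
      finally have "enn_powr (drearr f s) r * ennreal (b * s powr (r * d - 1))
        \<le> ennreal ((m * (t / s) powr d') powr r) * ennreal (b * s powr (r * d - 1))"
        by (rule mult_right_mono) simp
      also have "\<dots> = ennreal ((m * (t / s) powr d') powr r * (b * s powr (r * d - 1)))"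
        using assms by (simp add: ennreal_mult)
      also have "(m * (t / s) powr d') powr r * (b * s powr (r * d - 1)) = c * s powr (r * (d - d') - 1)"
        using assms s by (simp add: c_def powr_mult powr_divide powr_powr powr_diff powr_add field_simps)
      finally show ?thesis using c True by (simp add: ennreal_mult)
    qed simp
  qed
  also have "\<dots> = ennreal c * (\<integral>\<^sup>+ s \<in> B. ennreal (s powr (r * (d - d') - 1)) \<partial>lborel)"
    by (intro nn_integral_cmult) measurable
  also have "\<dots> \<le> ennreal c * ennreal (k * t powr (r * (d - d')))"
    using assms(9) by (rule mult_left_mono) simp
  also have "\<dots> = ennreal (c * (k * t powr (r * (d - d'))))"
    using c assms by (simp add: ennreal_mult)
  finally have "hardy B b d r f t \<le> ennreal (t powr (- d)) *
      enn_powr (ennreal (c * (k * t powr (r * (d - d'))))) (1 / r)"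
    unfolding hardy_def using assms(1) by (intro mult_left_mono enn_powr_mono) auto
  also have "\<dots> = ennreal (t powr (- d) * (c * (k * t powr (r * (d - d')))) powr (1 / r))"
    using assms c by (subst enn_powr_ennreal) (simp_all add: ennreal_mult')
  also have "c * (k * t powr (r * (d - d'))) = (b * k) * m powr r * t powr (r * d)"
    using assms by (simp add: c_def powr_mult powr_powr right_diff_distrib powr_diff mult_ac)
  also have "t powr (- d) * ((b * k) * m powr r * t powr (r * d)) powr (1 / r) = (b * k) powr (1 / r) * m"
    using assms by (simp add: powr_mult powr_powr powr_minus)
  finally show ?thesis using assms by (simp add: ennreal_mult)
qed

lemma nn_integral_inverse_Ioo:
  assumes "0 < a" "a \<le> b"
  shows "(\<integral>\<^sup>+ s \<in> {a<..<b}. ennreal (1 / s) \<partial>lborel) = ennreal (ln (b / a))"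
proof (rule nn_integral_has_integral_lebesgue')
  have "((\<lambda>s. 1 / s) has_integral (ln b - ln a)) {a..b}"
    using assms
    by (intro fundamental_theorem_of_calculus)
      (auto intro!: derivative_eq_intros simp: has_real_derivative_iff_has_vector_derivative[symmetric])
  then show "((\<lambda>s. 1 / s) has_integral ln (b / a)) {a<..<b}"
    using assms by (simp add: has_integral_Icc_iff_Ioo ln_div)
qed (use assms in auto)

text \<open>Where \<open>f*\<close> dominates the critical power \<open>c * s powr (- d)\<close>,
  the exponents cancel and the integrand is at least a multiple of \<open>1 / s\<close>. This is the
  source of the logarithm.\<close>

lemma hardy_lower:
  assumes "0 < r" "0 < t" "0 \<le> c" "0 \<le> b" "0 < x" "x \<le> y" "{x<..<y} \<subseteq> B"
    and "\<And>s. s \<in> {x<..<y} \<Longrightarrow> ennreal (c * s powr (- d)) \<le> drearr f s"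
  shows "ennreal (t powr (- d) * c * (b * ln (y / x)) powr (1 / r)) \<le> hardy B b d r f t"
proof -
  have ln: "0 \<le> ln (y / x)" using assms by simp
  have "ennreal (c powr r * b * ln (y / x)) = ennreal (c powr r * b) * ennreal (ln (y / x))"
    using assms ln by (simp add: ennreal_mult)
  also have "\<dots> = ennreal (c powr r * b) * (\<integral>\<^sup>+ s \<in> {x<..<y}. ennreal (1 / s) \<partial>lborel)"
    using assms by (simp add: nn_integral_inverse_Ioo)
  also have "\<dots> = (\<integral>\<^sup>+ s. ennreal (c powr r * b) * (ennreal (1 / s) * indicator {x<..<y} s) \<partial>lborel)"
    by (intro nn_integral_cmult[symmetric]) measurable
  also have "\<dots> \<le> (\<integral>\<^sup>+ s \<in> B. enn_powr (drearr f s) r * ennreal (b * s powr (r * d - 1)) \<partial>lborel)"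
  proof (rule nn_integral_mono)
    fix s
    show "ennreal (c powr r * b) * (ennreal (1 / s) * indicator {x<..<y} s)
      \<le> enn_powr (drearr f s) r * ennreal (b * s powr (r * d - 1)) * indicator B s"
    proof (cases "s \<in> {x<..<y}")
      case True
      then have s: "0 < s" "s \<in> B" using assms by auto
      have "ennreal (c powr r * b) * ennreal (1 / s) =
          ennreal ((c * s powr (- d)) powr r * (b * s powr (r * d - 1)))"
        using assms s
        by (simp add: ennreal_mult[symmetric] powr_mult powr_powr powr_minus powr_diff powr_divide field_simps)
      also have "\<dots> = enn_powr (ennreal (c * s powr (- d))) r * ennreal (b * s powr (r * d - 1))"
        using assms by (subst enn_powr_ennreal) (simp_all add: ennreal_mult')
      also have "\<dots> \<le> enn_powr (drearr f s) r * ennreal (b * s powr (r * d - 1))"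
        using assms(1) assms(8)[OF True] by (intro mult_right_mono enn_powr_mono) auto
      finally show ?thesis using s True by simp
    qed simp
  qed
  finally have "ennreal (t powr (- d)) * enn_powr (ennreal (c powr r * b * ln (y / x))) (1 / r) \<le> hardy B b d r f t"
    unfolding hardy_def using assms(1) by (intro mult_left_mono enn_powr_mono) auto
  also have "ennreal (t powr (- d)) * enn_powr (ennreal (c powr r * b * ln (y / x))) (1 / r)
      = ennreal (t powr (- d) * (c powr r * b * ln (y / x)) powr (1 / r))"
    using assms ln by (subst enn_powr_ennreal) (simp_all add: ennreal_mult')
  also have "(c powr r * b * ln (y / x)) powr (1 / r) = c * (b * ln (y / x)) powr (1 / r)"
    using assms ln by (simp add: powr_mult powr_powr)
  finally show ?thesis by (simp add: mult.assoc)
qed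

lemma nn_integral_powr_from_0:
  assumes "0 < e" "0 \<le> t"
  shows "(\<integral>\<^sup>+ s \<in> {0<..<t}. ennreal (s powr (e - 1)) \<partial>lborel) \<le> ennreal (1 / e * t powr e)"
proof -
  have "(\<integral>\<^sup>+ s \<in> {0<..<t}. ennreal (s powr (e - 1)) \<partial>lborel)
      \<le> (\<integral>\<^sup>+ s \<in> {0..t}. ennreal (s powr (e - 1)) \<partial>lborel)"
    by (intro nn_integral_mono) (auto simp: indicator_def)
  also have "\<dots> = ennreal (1 / e * t powr e)"
    using has_integral_powr_from_0[of "e - 1" t] assms
    by (intro nn_integral_has_integral_lebesgue') auto
  finally show ?thesis .
qed

lemma nn_integral_powr_to_inf:
  assumes "0 < e" "0 < t"
  shows "(\<integral>\<^sup>+ s \<in> {t<..}. ennreal (s powr (- e - 1)) \<partial>lborel) \<le> ennreal (1 / e * t powr (- e))"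
proof -
  have "(\<integral>\<^sup>+ s \<in> {t<..}. ennreal (s powr (- e - 1)) \<partial>lborel)
      \<le> (\<integral>\<^sup>+ s \<in> {t..}. ennreal (s powr (- e - 1)) \<partial>lborel)"
    by (intro nn_integral_mono) (auto simp: indicator_def)
  also have "\<dots> = ennreal (1 / e * t powr (- e))"
    using has_integral_powr_to_inf[of "- e - 1" t] assms
    by (intro nn_integral_has_integral_lebesgue') auto
  finally show ?thesis .
qed

lemma as_fun_mono_measurable:
  assumes "\<And>s t. 0 < s \<Longrightarrow> s \<le> t \<Longrightarrow> T s \<le> T t" "\<And>t. 0 < t \<Longrightarrow> T t \<noteq> top"
  shows "as_fun T \<in> borel_measurable borel"
proof -
  have "mono_on {0<..} (\<lambda>t. enn2real (T t))"
    using assms by (intro mono_onI) (auto intro!: enn2real_mono simp: less_top)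
  then have "(\<lambda>t. enn2real (T t)) \<in> borel_measurable (restrict_space borel {0<..})"
    by (rule borel_measurable_mono_on_fnc)
  then have "(\<lambda>t. if t \<in> {0<..} then enn2real (T t) else 0) \<in> borel_measurable borel"
    by (subst measurable_If_restrict_space_iff) (auto simp: greaterThan_def)
  then show ?thesis by (simp add: as_fun_def)
qed

text \<open>The product of \<open>t powr (- d)\<close> and the integral is not treated as a monotone
  function; instead the factor \<open>G\<close> is monotone in \<open>t\<close>, as the domain of
  integration either grows or shrinks.\<close>

lemma as_fun_hardy_measurable:
  assumes "0 < r" "\<And>t. 0 < t \<Longrightarrow> hardy (B t) b d r f t \<noteq> top"
    and "(\<forall>s t. s \<le> t \<longrightarrow> B s \<subseteq> B t) \<or> (\<forall>s t. s \<le> t \<longrightarrow> B t \<subseteq> B s)"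
  shows "as_fun (\<lambda>t. hardy (B t) b d r f t) \<in> borel_measurable lebesgue"
proof -
  define G where "G = (\<lambda>t. enn_powr (\<integral>\<^sup>+ s \<in> B t. enn_powr (drearr f s) r *
    ennreal (b * s powr (r * d - 1)) \<partial>lborel) (1 / r))"
  have fin: "G t \<noteq> top" if "0 < t" for t
    using assms(2)[OF that] that by (auto simp: hardy_def G_def ennreal_mult_eq_top_iff)
  have le: "G s \<le> G t" if "B s \<subseteq> B t" for s t
    unfolding G_def using assms(1) that
    by (intro enn_powr_mono nn_integral_mono mult_left_mono) (auto simp: indicator_def)
  from assms(3) have [measurable]: "as_fun G \<in> borel_measurable borel"
    using as_fun_mono_measurable[of G] as_fun_antimono_measurable[of G] le fin by metis
  have "as_fun (\<lambda>t. hardy (B t) b d r f t) = (\<lambda>t. t powr (- d) * as_fun G t)"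
    by (auto simp: as_fun_def hardy_def G_def enn2real_mult)
  also have "\<dots> \<in> borel_measurable borel" by measurable
  finally show ?thesis by (simp add: measurable_completion)
qed

section \<open>Boundedness of the integral operators\<close>

context ri
begin

text \<open>A single term of the supremum, solved for \<open>f*(s)\<close>; this is the power bound
  that \<open>hardy_upper\<close> requires.\<close>

lemma rearr_le_H_up_inf:
  assumes "f \<in> X" "0 < p" "0 < s" "s < t" "H_up_inf p f t \<noteq> top"
  shows "drearr f s \<le> ennreal (enn2real (H_up_inf p f t) * (t / s) powr (1 / p))"
proof -
  have "ennreal ((s / t) powr (1 / p) * rearr f s) \<le> H_up_inf p f t"
    unfolding H_up_inf_def using assms
    by (intro SUP_upper2[of s]) (auto simp: drearr_eq_rearr ennreal_mult rearr_nonneg)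
  then have "enn2real (ennreal ((s / t) powr (1 / p) * rearr f s)) \<le> enn2real (H_up_inf p f t)"
    using assms by (intro enn2real_mono) (auto simp: less_top)
  then have "(s / t) powr (1 / p) * rearr f s \<le> enn2real (H_up_inf p f t)"
    by (simp add: rearr_nonneg)
  then have "rearr f s \<le> enn2real (H_up_inf p f t) * (t / s) powr (1 / p)"
    using assms by (simp add: powr_divide field_simps)
  then show ?thesis using assms by (simp add: drearr_eq_rearr ennreal_leI)
qed

lemma rearr_le_H_low_sup:
  assumes "f \<in> X" "0 < q" "0 < t" "t < s" "H_low_sup q f t \<noteq> top"
  shows "drearr f s \<le> ennreal (enn2real (H_low_sup q f t) * (t / s) powr (1 / q))"
proof -
  have "ennreal ((s / t) powr (1 / q) * rearr f s) \<le> H_low_sup q f t"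
    unfolding H_low_sup_def using assms
    by (intro SUP_upper2[of s]) (auto simp: drearr_eq_rearr ennreal_mult rearr_nonneg)
  then have "enn2real (ennreal ((s / t) powr (1 / q) * rearr f s)) \<le> enn2real (H_low_sup q f t)"
    using assms by (intro enn2real_mono) (auto simp: less_top)
  then have "(s / t) powr (1 / q) * rearr f s \<le> enn2real (H_low_sup q f t)"
    by (simp add: rearr_nonneg)
  then have "rearr f s \<le> enn2real (H_low_sup q f t) * (t / s) powr (1 / q)"
    using assms by (simp add: powr_divide field_simps)
  then show ?thesis using assms by (simp add: drearr_eq_rearr ennreal_leI)
qed

lemma bounded_on_finite: "bounded_on X N T \<Longrightarrow> f \<in> X \<Longrightarrow> 0 < t \<Longrightarrow> T f t \<noteq> top"
  unfolding bounded_on_def by blast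

lemma bounded_on_hardy:
  assumes "bounded_on X N T" "0 < r"
    and le: "\<And>f t. f \<in> X \<Longrightarrow> 0 < t \<Longrightarrow> hardy (B t) b d r f t \<le> ennreal c * T f t"
    and B: "(\<forall>s t. s \<le> t \<longrightarrow> B s \<subseteq> B t) \<or> (\<forall>s t. s \<le> t \<longrightarrow> B t \<subseteq> B s)"
    and "0 \<le> c"
  shows "bounded_on X N (\<lambda>f t. hardy (B t) b d r f t)"
proof (rule bounded_on_dominated[OF assms(1,5) le])
  fix f assume f: "f \<in> X"
  have "hardy (B t) b d r f t \<noteq> top" if "0 < t" for t
  proof -
    have "ennreal c * T f t < top"
      using bounded_on_finite[OF assms(1) f that] by (simp add: ennreal_mult_less_top less_top)
    then show ?thesis using le[OF f that] by auto
  qed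
  then show "as_fun (\<lambda>t. hardy (B t) b d r f t) \<in> borel_measurable lebesgue"
    by (intro as_fun_hardy_measurable assms(2) B)
qed

text \<open>For \<open>e\<close> strictly between \<open>p\<close> and the lower index, the supremum
  operator with exponent \<open>e\<close> is bounded, and its power bound on \<open>f*\<close> is
  integrable at 0 against the kernel because \<open>1 / e < 1 / p\<close>.\<close>

lemma bounded_on_H_up:
  assumes "0 < p" "0 < r" "ereal p < lower_boyd X N"
  shows "bounded_on X N (H_up p r)"
proof -
  obtain e where "ereal p < ereal e" "ereal e < lower_boyd X N"
    using ereal_dense2[OF assms(3)] by blast
  then have e: "p < e" "ereal e < lower_boyd X N" by auto
  then have bd: "bounded_on X N (H_up_inf e)" using bounded_on_H_up_inf assms(1) by simp
  have pos: "0 < r * (1 / p - 1 / e)" using assms e by (simp add: frac_less2)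
  have "bounded_on X N (\<lambda>f t. hardy {0<..<t} (r / p) (1 / p) r f t)"
  proof (rule bounded_on_hardy[OF bd assms(2)])
    fix f and t :: real assume ft: "f \<in> X" "0 < t"
    note fin = bounded_on_finite[OF bd ft]
    have "hardy {0<..<t} (r / p) (1 / p) r f t \<le>
        ennreal ((r / p * (1 / (r * (1 / p - 1 / e)))) powr (1 / r)) * ennreal (enn2real (H_up_inf e f t))"
      using assms e ft pos nn_integral_powr_from_0[OF pos, of t] rearr_le_H_up_inf[OF ft(1) _ _ _ fin]
      by (intro hardy_upper[where d' = "1 / e"]) (auto simp del: times_divide_eq_right)
    then show "hardy {0<..<t} (r / p) (1 / p) r f t \<le>
        ennreal ((r / p * (1 / (r * (1 / p - 1 / e)))) powr (1 / r)) * H_up_inf e f t"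
      using fin by (simp add: less_top)
  qed auto
  then show ?thesis by (simp add: H_up_eq_hardy[abs_def])
qed

text \<open>The gap \<open>d < 1 / e\<close> makes the integral converge at infinity. The case
  \<open>d = 0\<close> covers \<open>q = \<infinity>\<close>.\<close>

lemma bounded_on_hardy_low:
  assumes "0 \<le> d" "0 \<le> b" "0 < r" "0 < e" "upper_boyd X N < ereal e" "d < 1 / e"
  shows "bounded_on X N (\<lambda>f t. hardy {t<..} b d r f t)"
proof -
  have bd: "bounded_on X N (H_low_sup e)" using bounded_on_H_low_sup assms by simp
  have pos: "0 < r * (1 / e - d)" using assms by simp
  have eq: "- (r * (1 / e - d)) = r * (d - 1 / e)" by (simp add: algebra_simps)
  show ?thesis
  proof (rule bounded_on_hardy[OF bd assms(3)])
    fix f and t :: real assume ft: "f \<in> X" "0 < t"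
    note fin = bounded_on_finite[OF bd ft]
    have "hardy {t<..} b d r f t \<le>
        ennreal ((b * (1 / (r * (1 / e - d)))) powr (1 / r)) * ennreal (enn2real (H_low_sup e f t))"
      using assms ft pos nn_integral_powr_to_inf[OF pos ft(2)] rearr_le_H_low_sup[OF ft(1) assms(4) ft(2) _ fin]
      unfolding eq
      by (intro hardy_upper[where d' = "1 / e"]) (auto simp del: times_divide_eq_right)
    then show "hardy {t<..} b d r f t \<le>
        ennreal ((b * (1 / (r * (1 / e - d)))) powr (1 / r)) * H_low_sup e f t"
      using fin by (simp add: less_top)
  qed auto
qed

lemma bounded_on_cong:
  assumes "\<And>f t. 0 < t \<Longrightarrow> S f t = T f t"
  shows "bounded_on X N S \<longleftrightarrow> bounded_on X N T"
proof -
  have "as_fun (S f) = as_fun (T f)" for f using assms by (auto simp: as_fun_def)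
  then show ?thesis using assms unfolding bounded_on_def by simp
qed

lemma bounded_on_H_low:
  assumes "0 < q" "0 < r" "upper_boyd X N < q"
  shows "bounded_on X N (H_low q r)"
proof -
  \<comment> \<open>A member \<open>q'\<close> of the set defining the infimum is positive, so every
    \<open>e\<close> above it is a positive real or infinite; between \<open>q'\<close> and
    \<open>q\<close> a real one exists even for \<open>q = \<infinity>\<close>.\<close>
  obtain q' where q': "ereal q' < q" "0 < q'" "upper_boyd X N \<le> ereal q'"
  proof -
    obtain x where "x \<in> {ereal q | q. 0 < q \<and> (\<exists>c. \<forall>a. 1 < a \<longrightarrow>
      (\<forall>f\<in>X. dil a f \<in> X \<and> N (dil a f) \<le> c * a powr (-1/q) * N f))}" "x < q"
      using assms(3) unfolding upper_boyd_def Inf_less_iff by blast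
    moreover from this have "upper_boyd X N \<le> x" unfolding upper_boyd_def by (intro Inf_lower)
    ultimately show ?thesis using that by blast
  qed
  obtain e where "ereal q' < ereal e" "ereal e < q"
    using ereal_dense2[OF q'(1)] by blast
  then have e: "q' < e" "ereal e < q" by auto
  have ub: "upper_boyd X N < ereal e" using q'(3) e(1) by (auto intro: le_less_trans)
  show ?thesis
  proof (cases q)
    case (real q1)
    have "bounded_on X N (\<lambda>f t. hardy {t<..} (r / q1) (1 / q1) r f t)"
      using real assms e q' by (intro bounded_on_hardy_low[OF _ _ _ _ ub]) (auto simp: frac_less2)
    then show ?thesis using real by (simp add: H_low_def H_low_fin_eq_hardy[abs_def])
  next
    case PInf
    have "bounded_on X N (\<lambda>f t. hardy {t<..} 1 0 r f t)"
      using assms e q' by (intro bounded_on_hardy_low[OF _ _ _ _ ub]) auto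
    then show ?thesis using PInf bounded_on_cong[OF H_low_inf_eq_hardy] by (simp add: H_low_def)
  qed (use assms in auto)
qed

subsection \<open>Necessity\<close>

text \<open>Only the part of the integral over \<open>(y / 2, y)\<close> is kept. There
  \<open>f*\<close> is at least \<open>f*(y)\<close>, and \<open>s powr d\<close> is at least
  \<open>(y / 2) powr d\<close>, which gives the critical power; the logarithm is
  \<open>ln 2\<close>.\<close>

lemma hardy_ge_rearr:
  assumes "f \<in> X" "0 < r" "0 \<le> d" "0 < b" "0 < y" "0 < x" "{y / 2<..<y} \<subseteq> B"
  shows "ennreal (2 powr (- d) * (b * ln 2) powr (1 / r) * (y / x) powr d * rearr f y) \<le> hardy B b d r f x"
proof -
  have "ennreal (rearr f y * (y / 2) powr d * s powr (- d)) \<le> drearr f s" if s: "s \<in> {y / 2<..<y}" for s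
  proof -
    have "0 < s" using s assms by auto
    have "(y / 2) powr d \<le> s powr d" using s assms by (intro powr_mono2) auto
    then have "rearr f y * ((y / 2) powr d * s powr (- d)) \<le> rearr f s * 1"
      using s assms \<open>0 < s\<close> by (intro mult_mono rearr_antimono) (auto simp: rearr_nonneg powr_minus field_simps)
    then show ?thesis using drearr_eq_rearr[OF assms(1) \<open>0 < s\<close>] by (simp add: ennreal_leI mult.assoc)
  qed
  then have "ennreal (x powr (- d) * (rearr f y * (y / 2) powr d) * (b * ln (y / (y / 2))) powr (1 / r)) \<le> hardy B b d r f x"
    using assms by (intro hardy_lower) (auto simp: rearr_nonneg)
  also have "x powr (- d) * (rearr f y * (y / 2) powr d) * (b * ln (y / (y / 2))) powr (1 / r)
      = 2 powr (- d) * (b * ln 2) powr (1 / r) * (y / x) powr d * rearr f y"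
    using assms by (simp add: powr_divide powr_minus field_simps)
  finally show ?thesis .
qed

text \<open>Meant for \<open>g\<close> the result of a first application of the operator. The bound
  on \<open>g\<close> holds on \<open>(0, 2 * s)\<close>, longer than \<open>(0, s)\<close>, and so
  bounds \<open>g*(s)\<close> from below by the critical power on the whole of
  \<open>(u, v)\<close>.\<close>

lemma hardy_as_fun_ge:
  assumes "g \<in> borel_measurable lebesgue" "0 < r" "0 \<le> d" "0 < b" "0 < t" "0 < y" "0 \<le> m"
    and "0 < u" "u \<le> v" "{u<..<v} \<subseteq> B"
    and "\<And>s x. u < s \<Longrightarrow> s < v \<Longrightarrow> 0 < x \<Longrightarrow> x < 2 * s \<Longrightarrow> (y / (2 * s)) powr d * m \<le> g x"
  shows "ennreal ((y / (2 * t)) powr d * m * (b * ln (v / u)) powr (1 / r)) \<le> hardy B b d r g t"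
proof -
  have "ennreal ((y / 2) powr d * m * s powr (- d)) \<le> drearr g s" if s: "s \<in> {u<..<v}" for s
  proof -
    have "0 < s" using s assms by auto
    then have "(y / 2) powr d * m * s powr (- d) = (y / (2 * s)) powr d * m"
      using assms by (simp add: powr_divide powr_minus powr_mult field_simps)
    moreover have "ennreal ((y / (2 * s)) powr d * m) \<le> drearr g s"
    proof (rule drearr_geI[OF assms(1)])
      fix x assume x: "0 < x" "x < 2 * s"
      then show "(y / (2 * s)) powr d * m \<le> \<bar>g x\<bar>" using assms(11)[of s x] s by auto
    qed (use \<open>0 < s\<close> in auto)
    ultimately show ?thesis by (simp only:)
  qed
  then have "ennreal (t powr (- d) * ((y / 2) powr d * m) * (b * ln (v / u)) powr (1 / r)) \<le> hardy B b d r g t"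
    using assms by (intro hardy_lower) auto
  also have "t powr (- d) * ((y / 2) powr d * m) * (b * ln (v / u)) powr (1 / r)
      = (y / (2 * t)) powr d * m * (b * ln (v / u)) powr (1 / r)"
    using assms by (simp add: powr_divide powr_minus powr_mult field_simps)
  finally show ?thesis .
qed

text \<open>Two applications cost \<open>C\<^sup>2\<close> by \<open>T(4)\<close> and the norm
  bounds; equimeasurability then replaces \<open>f*\<close> by \<open>f\<close> inside the
  dilation.\<close>

lemma dil_bound_of_twice:
  assumes T: "\<And>f t. f \<in> X \<Longrightarrow> 0 < t \<Longrightarrow> T f t \<noteq> top" "\<And>f. f \<in> X \<Longrightarrow> as_fun (T f) \<in> X"
      "\<And>f. f \<in> X \<Longrightarrow> N (as_fun (T f)) \<le> C * N f" "0 \<le> C"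
    and "f \<in> X" "0 < a" "0 < m"
    and le: "\<And>t. 0 < t \<Longrightarrow> ennreal (m * rearr f (a * t)) \<le> T (as_fun (T f)) t"
  shows "dil a f \<in> X" "m * N (dil a f) \<le> C\<^sup>2 * N f"
proof -
  define h where "h = as_fun (T (as_fun (T f)))"
  have h: "h \<in> X" "N h \<le> C\<^sup>2 * N f"
  proof -
    show "h \<in> X" unfolding h_def by (intro T assms)
    have "N h \<le> C * N (as_fun (T f))" unfolding h_def by (intro T assms)
    also have "\<dots> \<le> C * (C * N f)" by (intro mult_left_mono T assms)
    finally show "N h \<le> C\<^sup>2 * N f" by (simp add: power2_eq_square mult_ac)
  qed
  have pt: "\<bar>m * dil a (rearr f) x\<bar> \<le> \<bar>h x\<bar>" for x
  proof (cases "0 < x")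
    case True
    have "enn2real (ennreal (m * rearr f (a * x))) \<le> enn2real (T (as_fun (T f)) x)"
      using le[OF True] T(1)[OF T(2)[OF assms(5)] True] by (intro enn2real_mono) (auto simp: less_top)
    then show ?thesis using True assms(7) by (simp add: h_def dil_def as_fun_def rearr_nonneg)
  next
    case False
    then have "\<not> 0 < a * x" using assms(6) by (simp add: zero_less_mult_iff)
    then show ?thesis by (simp add: dil_def rearr_def as_fun_def)
  qed
  have meas: "dil a (rearr f) \<in> borel_measurable lebesgue"
    by (intro lebesgue_measurable_dil X_measurable X_rearr assms)
  then have "(\<lambda>x. m * dil a (rearr f) x) \<in> borel_measurable lebesgue" by measurable
  note D = dominated[OF h(1) this pt]
  have R: "dil a (rearr f) \<in> X"
    using X_scale[OF D(1), of "1 / m"] assms(7) by simp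
  then have "m * N (dil a (rearr f)) \<le> N h"
    using D(2) N_scale[OF R, of m] assms(7) by simp
  moreover note dil_mono[OF assms(5,6) order_refl R]
  moreover have "distr_fun f t \<le> distr_fun (rearr f) t" if "0 \<le> t" for t
    using distr_rearr[OF assms(5) that] by simp
  ultimately have *: "dil a f \<in> X" "N (dil a f) \<le> N (dil a (rearr f))" by blast+
  then have "m * N (dil a f) \<le> m * N (dil a (rearr f))" using assms(7) by (intro mult_left_mono) auto
  then show "dil a f \<in> X" "m * N (dil a f) \<le> C\<^sup>2 * N f"
    using * h(2) \<open>m * N (dil a (rearr f)) \<le> N h\<close> by auto
qed

lemma bounded_onE:
  assumes "bounded_on X N T"
  obtains C where "0 \<le> C" "\<And>f t. f \<in> X \<Longrightarrow> 0 < t \<Longrightarrow> T f t \<noteq> top" "\<And>f. f \<in> X \<Longrightarrow> as_fun (T f) \<in> X"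
    "\<And>f. f \<in> X \<Longrightarrow> N (as_fun (T f)) \<le> C * N f"
proof -
  obtain C where C: "\<forall>f\<in>X. (\<forall>t>0. T f t \<noteq> top) \<and> as_fun (T f) \<in> X \<and> N (as_fun (T f)) \<le> C * N f"
    using assms unfolding bounded_on_def by blast
  have "N (as_fun (T f)) \<le> max 0 C * N f" if "f \<in> X" for f
    using C that mult_right_mono[OF max.cobounded2[of C 0] N_nonneg[OF that]] by (meson order_trans)
  then show ?thesis using that[of "max 0 C"] C by auto
qed

text \<open>The first application is bounded below in terms of \<open>f*(y)\<close> with
  \<open>y = exp (- L) * t\<close>; the second integrates this bound over \<open>(y, t)\<close>,
  where the kernel contributes \<open>ln (t / y) = L\<close>.\<close>

lemma dil_bound_H_up:
  assumes "0 \<le> d" "0 < r" "0 < b" "bounded_on X N (\<lambda>f t. hardy {0<..<t} b d r f t)"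
  obtains A where "0 \<le> A" "\<And>L f. 0 < L \<Longrightarrow> f \<in> X \<Longrightarrow> dil (exp (- L)) f \<in> X"
    "\<And>L f. 0 < L \<Longrightarrow> f \<in> X \<Longrightarrow> L powr (1 / r) * N (dil (exp (- L)) f) \<le> A * exp (L * d) * N f"
proof -
  obtain C where C: "0 \<le> C" "\<And>f t. f \<in> X \<Longrightarrow> 0 < t \<Longrightarrow> hardy {0<..<t} b d r f t \<noteq> top"
    "\<And>f. f \<in> X \<Longrightarrow> as_fun (\<lambda>t. hardy {0<..<t} b d r f t) \<in> X"
    "\<And>f. f \<in> X \<Longrightarrow> N (as_fun (\<lambda>t. hardy {0<..<t} b d r f t)) \<le> C * N f"
    by (rule bounded_onE[OF assms(4)]) blast
  define k where "k = 2 powr (- d) * (b * ln 2) powr (1 / r)"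
  have k: "0 < k" using assms by (simp add: k_def)
  define M where "M = 2 powr (- d) * k * b powr (1 / r)"
  have M: "0 < M" using assms k by (simp add: M_def)
  have *: "dil (exp (- L)) f \<in> X \<and> (M * exp (- L * d) * L powr (1 / r)) * N (dil (exp (- L)) f) \<le> C\<^sup>2 * N f"
    if "0 < L" and f: "f \<in> X" for L f
  proof -
    define g where "g = as_fun (\<lambda>t. hardy {0<..<t} b d r f t)"
    have g: "g \<in> X" unfolding g_def by (rule C(3)[OF f])
    have ge: "k * (y / x) powr d * rearr f y \<le> g x" if "0 < y" "y \<le> x" for x y
    proof -
      have "{y / 2<..<y} \<subseteq> {0<..<x}" using that by auto
      then have "ennreal (k * (y / x) powr d * rearr f y) \<le> hardy {0<..<x} b d r f x"
        unfolding k_def using that assms f by (intro hardy_ge_rearr) auto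
      then have "enn2real (ennreal (k * (y / x) powr d * rearr f y)) \<le> enn2real (hardy {0<..<x} b d r f x)"
        using C(2)[OF f, of x] that by (intro enn2real_mono) (auto simp: less_top)
      then show ?thesis using that k by (simp add: g_def as_fun_def rearr_nonneg)
    qed
    have "ennreal (M * exp (- L * d) * L powr (1 / r) * rearr f (exp (- L) * t)) \<le> hardy {0<..<t} b d r g t"
      if t: "0 < t" for t
    proof -
      define y where "y = exp (- L) * t"
      have y: "0 < y" "y < t" using t \<open>0 < L\<close> by (auto simp: y_def)
      \<comment> \<open>For \<open>x \<ge> y\<close> the value \<open>f*(y)\<close> bounds
        \<open>g x\<close> directly. For \<open>x < y\<close> the bound is taken at \<open>x\<close>
        itself, with \<open>f*(x) \<ge> f*(y)\<close> and the power at most 1.\<close>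
      have gs: "(y / (2 * s)) powr d * (k * rearr f y) \<le> g x" if s: "y < s" "s < t" "0 < x" "x < 2 * s" for s x
      proof (cases "y \<le> x")
        case True
        have "(y / (2 * s)) powr d * (k * rearr f y) \<le> (y / x) powr d * (k * rearr f y)"
          using y s k assms by (intro mult_right_mono powr_mono2 frac_le) (auto simp: rearr_nonneg)
        then show ?thesis using ge[OF y(1) True] by (simp add: mult_ac)
      next
        case False
        have "(y / (2 * s)) powr d * (k * rearr f y) \<le> 1 * (k * rearr f x)"
          using y s k assms False f
          by (intro mult_mono mult_left_mono rearr_antimono powr_le1) (auto simp: rearr_nonneg)
        then show ?thesis using ge[of x x] s by simp
      qed
      have "ennreal ((y / (2 * t)) powr d * (k * rearr f y) * (b * ln (t / y)) powr (1 / r)) \<le> hardy {0<..<t} b d r g t"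
        using y t assms k gs by (intro hardy_as_fun_ge X_measurable g) (auto simp: rearr_nonneg)
      moreover have "t / y = exp L" using t by (simp add: y_def exp_minus field_simps)
      then have "ln (t / y) = L" by simp
      moreover have "y / (2 * t) = exp (- L) / 2" using t by (simp add: y_def)
      then have "(y / (2 * t)) powr d = 2 powr (- d) * exp (- L * d)"
        by (simp only:) (simp add: powr_divide exp_powr_real powr_minus_divide)
      moreover have "(b * L) powr (1 / r) = b powr (1 / r) * L powr (1 / r)"
        using assms \<open>0 < L\<close> by (simp add: powr_mult)
      ultimately have "ennreal (2 powr (- d) * exp (- L * d) * (k * rearr f y) * (b powr (1 / r) * L powr (1 / r)))
          \<le> hardy {0<..<t} b d r g t"
        by (simp only:)
      then show ?thesis unfolding M_def y_def by (simp only: mult_ac)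
    qed
    then show ?thesis
      using dil_bound_of_twice[of "\<lambda>f t. hardy {0<..<t} b d r f t", OF C(2,3,4,1) f,
          of "exp (- L)" "M * exp (- L * d) * L powr (1 / r)"] M \<open>0 < L\<close>
      by (simp add: g_def)
  qed
  show ?thesis
  proof (rule that[of "C\<^sup>2 / M"])
    fix L :: real and f assume "0 < L" and f: "f \<in> X"
    from * [OF this] show "dil (exp (- L)) f \<in> X"
      "L powr (1 / r) * N (dil (exp (- L)) f) \<le> C\<^sup>2 / M * exp (L * d) * N f"
      using M by (simp_all add: exp_minus field_simps)
  qed (use M in auto)
qed

text \<open>With \<open>y = exp L * t\<close> the window of the second integration is
  \<open>(t, y / 4)\<close>: then \<open>x < 2 * s\<close> implies \<open>x < y / 2\<close>, so
  \<open>(y / 2, y)\<close> lies to the right of \<open>x\<close>. The window has logarithmic length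
  \<open>L - ln 4\<close>.\<close>

lemma dil_bound_H_low:
  assumes "0 \<le> d" "0 < r" "0 < b" "bounded_on X N (\<lambda>f t. hardy {t<..} b d r f t)"
  obtains A where "0 \<le> A" "\<And>L f. ln 4 < L \<Longrightarrow> f \<in> X \<Longrightarrow> dil (exp L) f \<in> X"
    "\<And>L f. ln 4 < L \<Longrightarrow> f \<in> X \<Longrightarrow> (L - ln 4) powr (1 / r) * N (dil (exp L) f) \<le> A * exp (- L * d) * N f"
proof -
  obtain C where C: "0 \<le> C" "\<And>f t. f \<in> X \<Longrightarrow> 0 < t \<Longrightarrow> hardy {t<..} b d r f t \<noteq> top"
    "\<And>f. f \<in> X \<Longrightarrow> as_fun (\<lambda>t. hardy {t<..} b d r f t) \<in> X"
    "\<And>f. f \<in> X \<Longrightarrow> N (as_fun (\<lambda>t. hardy {t<..} b d r f t)) \<le> C * N f"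
    by (rule bounded_onE[OF assms(4)]) blast
  define k where "k = 2 powr (- d) * (b * ln 2) powr (1 / r)"
  have k: "0 < k" using assms by (simp add: k_def)
  define M where "M = 2 powr (- d) * k * b powr (1 / r)"
  have M: "0 < M" using assms k by (simp add: M_def)
  have *: "dil (exp L) f \<in> X \<and> (M * exp (L * d) * (L - ln 4) powr (1 / r)) * N (dil (exp L) f) \<le> C\<^sup>2 * N f"
    if L: "ln 4 < L" and f: "f \<in> X" for L f
  proof -
    define g where "g = as_fun (\<lambda>t. hardy {t<..} b d r f t)"
    have g: "g \<in> X" unfolding g_def by (rule C(3)[OF f])
    have ge: "k * (y / x) powr d * rearr f y \<le> g x" if "0 < x" "x \<le> y / 2" for x y
    proof -
      have "{y / 2<..<y} \<subseteq> {x<..}" using that by auto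
      then have "ennreal (k * (y / x) powr d * rearr f y) \<le> hardy {x<..} b d r f x"
        unfolding k_def using that assms f by (intro hardy_ge_rearr) auto
      then have "enn2real (ennreal (k * (y / x) powr d * rearr f y)) \<le> enn2real (hardy {x<..} b d r f x)"
        using C(2)[OF f, of x] that by (intro enn2real_mono) (auto simp: less_top)
      then show ?thesis using that k by (simp add: g_def as_fun_def rearr_nonneg)
    qed
    have exp4: "4 < exp L" using L by (metis exp_less_mono exp_ln zero_less_numeral)
    have "ennreal (M * exp (L * d) * (L - ln 4) powr (1 / r) * rearr f (exp L * t)) \<le> hardy {t<..} b d r g t"
      if t: "0 < t" for t
    proof -
      define y where "y = exp L * t"
      have y: "0 < y" "t < y / 4" using t exp4 by (auto simp: y_def)
      have gs: "(y / (2 * s)) powr d * (k * rearr f y) \<le> g x" if s: "t < s" "s < y / 4" "0 < x" "x < 2 * s" for s x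
      proof -
        have "(y / (2 * s)) powr d * (k * rearr f y) \<le> (y / x) powr d * (k * rearr f y)"
          using y s k assms by (intro mult_right_mono powr_mono2 frac_le) (auto simp: rearr_nonneg)
        then show ?thesis using ge[of x y] s by (simp add: mult_ac)
      qed
      have "ennreal ((y / (2 * t)) powr d * (k * rearr f y) * (b * ln (y / 4 / t)) powr (1 / r)) \<le> hardy {t<..} b d r g t"
        using y t assms k gs by (intro hardy_as_fun_ge X_measurable g) (auto simp: rearr_nonneg)
      moreover have "ln (y / 4 / t) = L - ln 4" using t by (simp add: y_def ln_div)
      moreover have "y / (2 * t) = exp L / 2" using t by (simp add: y_def)
      then have "(y / (2 * t)) powr d = 2 powr (- d) * exp (L * d)"
        by (simp only:) (simp add: powr_divide exp_powr_real powr_minus_divide)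
      moreover have "(b * (L - ln 4)) powr (1 / r) = b powr (1 / r) * (L - ln 4) powr (1 / r)"
        using assms L by (simp add: powr_mult)
      ultimately have "ennreal (2 powr (- d) * exp (L * d) * (k * rearr f y) * (b powr (1 / r) * (L - ln 4) powr (1 / r)))
          \<le> hardy {t<..} b d r g t"
        by (simp only:)
      then show ?thesis unfolding M_def y_def by (simp only: mult_ac)
    qed
    then show ?thesis
      using dil_bound_of_twice[of "\<lambda>f t. hardy {t<..} b d r f t", OF C(2,3,4,1) f,
          of "exp L" "M * exp (L * d) * (L - ln 4) powr (1 / r)"] M L
      by (simp add: g_def)
  qed
  show ?thesis
  proof (rule that[of "C\<^sup>2 / M"])
    fix L :: real and f assume "ln 4 < L" and f: "f \<in> X"
    from * [OF this] show "dil (exp L) f \<in> X"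
      "(L - ln 4) powr (1 / r) * N (dil (exp L) f) \<le> C\<^sup>2 / M * exp (- L * d) * N f"
      using M by (simp_all add: exp_minus field_simps)
  qed (use M in auto)
qed

section \<open>From one dilation to a Boyd index\<close>

lemma dil_dil: "dil a (dil b f) = dil (b * a) f"
  by (simp add: dil_def mult.assoc)

lemma dil_iterate:
  assumes "0 \<le> c" "\<And>f. f \<in> X \<Longrightarrow> dil a f \<in> X" "\<And>f. f \<in> X \<Longrightarrow> N (dil a f) \<le> c * N f" "f \<in> X"
  shows "dil (a ^ n) f \<in> X \<and> N (dil (a ^ n) f) \<le> c ^ n * N f"
proof (induction n)
  case 0
  then show ?case using assms(4) by (simp add: dil_def)
next
  case (Suc n)
  have "N (dil a (dil (a ^ n) f)) \<le> c * N (dil (a ^ n) f)" using Suc by (intro assms) auto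
  also have "\<dots> \<le> c * (c ^ n * N f)" using Suc assms(1) by (intro mult_left_mono) auto
  finally show ?case using assms(2)[of "dil (a ^ n) f"] Suc by (simp add: dil_dil mult_ac)
qed

text \<open>Any \<open>a < 1\<close> is compared with a power of the single dilation
  \<open>exp (- L)\<close>; the rounding of the exponent costs the constant
  \<open>exp (L * e)\<close>.\<close>

lemma lower_boyd_ge:
  assumes "0 < L" "0 < e" "\<And>f. f \<in> X \<Longrightarrow> dil (exp (- L)) f \<in> X"
    "\<And>f. f \<in> X \<Longrightarrow> N (dil (exp (- L)) f) \<le> exp (L * e) * N f"
  shows "ereal (1 / e) \<le> lower_boyd X N"
  unfolding lower_boyd_def
proof (rule Sup_upper, rule CollectI, intro exI conjI allI impI ballI, rule refl)
  show "0 < 1 / e" using assms by simp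
  fix a f assume a: "0 < a \<and> a < (1::real)" and f: "f \<in> X"
  \<comment> \<open>Rounding up puts the power below \<open>a\<close>, where the norm of the
    dilation is larger.\<close>
  define n where "n = nat \<lceil>- ln a / L\<rceil>"
  have "0 < - ln a / L" using a assms(1) by (intro divide_pos_pos) auto
  then have n: "- ln a / L \<le> real n" "real n \<le> - ln a / L + 1" unfolding n_def by linarith+
  have D: "dil (exp (- L) ^ n) f \<in> X \<and> N (dil (exp (- L) ^ n) f) \<le> exp (L * e) ^ n * N f"
    using assms f by (intro dil_iterate) auto
  have "- ln a \<le> L * real n" using n(1) assms(1) by (simp add: field_simps)
  then have "exp (- L * real n) \<le> exp (ln a)" by simp
  then have le: "exp (- L) ^ n \<le> a" using a by (simp add: exp_of_nat2_mult[symmetric])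
  note dil_mono[OF f _ le, of f]
  then have E: "dil a f \<in> X" "N (dil a f) \<le> N (dil (exp (- L) ^ n) f)" using D by auto
  show "dil a f \<in> X" by (rule E)
  have "real n * (L * e) \<le> (- ln a / L + 1) * (L * e)"
    using n(2) assms by (intro mult_right_mono) auto
  also have "\<dots> = L * e + (- e) * ln a" using assms by (simp add: field_simps)
  finally have "exp (L * e) ^ n \<le> exp (L * e + (- e) * ln a)" by (simp add: exp_of_nat_mult[symmetric])
  also have "\<dots> = exp (L * e) * a powr (- 1 / (1 / e))"
    using a assms by (simp add: powr_def exp_diff exp_minus divide_inverse)
  finally have "exp (L * e) ^ n * N f \<le> exp (L * e) * a powr (- 1 / (1 / e)) * N f"
    by (intro mult_right_mono N_nonneg f)
  then show "N (dil a f) \<le> exp (L * e) * a powr (- 1 / (1 / e)) * N f" using E D by linarith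
qed

lemma upper_boyd_le:
  assumes "0 < L" "0 < e" "\<And>f. f \<in> X \<Longrightarrow> dil (exp L) f \<in> X"
    "\<And>f. f \<in> X \<Longrightarrow> N (dil (exp L) f) \<le> exp (- L * e) * N f"
  shows "upper_boyd X N \<le> ereal (1 / e)"
  unfolding upper_boyd_def
proof (rule Inf_lower, rule CollectI, intro exI conjI allI impI ballI, rule refl)
  show "0 < 1 / e" using assms by simp
  fix a f assume a: "(1::real) < a" and f: "f \<in> X"
  \<comment> \<open>For \<open>a > 1\<close> rounding down puts the power below \<open>a\<close>; it
    may be the identity, with \<open>n = 0\<close>.\<close>
  define n where "n = nat \<lfloor>ln a / L\<rfloor>"
  have "0 < ln a / L" using a assms by simp
  then have n: "real n \<le> ln a / L" "ln a / L - 1 \<le> real n" unfolding n_def by linarith+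
  have D: "dil (exp L ^ n) f \<in> X \<and> N (dil (exp L ^ n) f) \<le> exp (- L * e) ^ n * N f"
    using assms f by (intro dil_iterate) auto
  have "L * real n \<le> ln a" using n(1) assms(1) by (simp add: field_simps)
  then have "exp (L * real n) \<le> exp (ln a)" by simp
  then have le: "exp L ^ n \<le> a" using a by (simp add: exp_of_nat2_mult[symmetric])
  note dil_mono[OF f _ le, of f]
  then have E: "dil a f \<in> X" "N (dil a f) \<le> N (dil (exp L ^ n) f)" using D by auto
  show "dil a f \<in> X" by (rule E)
  have "(ln a / L - 1) * (L * e) \<le> real n * (L * e)"
    using n(2) assms by (intro mult_right_mono) auto
  moreover have "(ln a / L - 1) * (L * e) = ln a * e - L * e"
    using assms(1) by (simp add: left_diff_distrib)
  ultimately have "real n * (- L * e) \<le> L * e + (- e) * ln a" by (simp add: algebra_simps)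
  then have "exp (- L * e) ^ n \<le> exp (L * e + (- e) * ln a)"
    unfolding exp_of_nat_mult[symmetric] by simp
  also have "\<dots> = exp (L * e) * a powr (- 1 / (1 / e))"
    using a assms by (simp add: powr_def exp_diff exp_minus divide_inverse)
  finally have "exp (- L * e) ^ n * N f \<le> exp (L * e) * a powr (- 1 / (1 / e)) * N f"
    by (intro mult_right_mono N_nonneg f)
  then show "N (dil a f) \<le> exp (L * e) * a powr (- 1 / (1 / e)) * N f" using E D by linarith
qed

section \<open>Strict inequalities for the indices\<close>

lemma ex_powr_inverse_ge:
  fixes A :: real
  assumes "0 < r" "0 \<le> A"
  shows "\<exists>L>m. 2 * A \<le> (L - c) powr (1 / r)"
proof -
  define L where "L = max (m + 1) (c + (2 * A) powr r)"
  have "2 * A = ((2 * A) powr r) powr (1 / r)" using assms by (simp add: powr_powr)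
  also have "\<dots> \<le> (L - c) powr (1 / r)" using assms by (intro powr_mono2) (auto simp: L_def)
  finally show ?thesis by (intro exI[of _ L]) (auto simp: L_def)
qed

lemma le_half_of_scaled_le:
  assumes "l * x \<le> A * E * y" "2 * A \<le> l" "0 \<le> x" "0 \<le> E" "0 \<le> y" "0 < l"
  shows "x \<le> E / 2 * (y::real)"
proof -
  have "2 * A * (E * y) \<le> l * (E * y)" using assms by (intro mult_right_mono) auto
  then have "l * x \<le> l * (E / 2 * y)" using assms(1) by (simp add: mult_ac)
  then show ?thesis using assms(6) by simp
qed

text \<open>A single application of the operator only yields \<open>N (D\<^sub>a f) \<le> c a\<^bsup>-1/p\<^esup> N f\<close>, which misses the
  strict inequality; the second application gains the logarithmic factor.\<close>

lemma lower_boyd_gt: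
  assumes "0 < p" "0 < r" "bounded_on X N (H_up p r)"
  shows "ereal p < lower_boyd X N"
proof -
  have bd: "bounded_on X N (\<lambda>f t. hardy {0<..<t} (r / p) (1 / p) r f t)"
    using assms(3) by (simp add: H_up_eq_hardy[abs_def])
  have pos: "0 \<le> 1 / p" "0 < r / p" using assms(1,2) by auto
  obtain A where A: "0 \<le> A" "\<And>L f. 0 < L \<Longrightarrow> f \<in> X \<Longrightarrow> dil (exp (- L)) f \<in> X"
    "\<And>L f. 0 < L \<Longrightarrow> f \<in> X \<Longrightarrow> L powr (1 / r) * N (dil (exp (- L)) f) \<le> A * exp (L * (1 / p)) * N f"
    by (rule dil_bound_H_up[OF pos(1) assms(2) pos(2) bd]) blast
  \<comment> \<open>The second condition makes the logarithmic gain beat \<open>2 * A\<close>, and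
    the first keeps \<open>e\<close> below positive.\<close>
  obtain L where L: "p * ln 2 < L" "2 * A \<le> (L - 0) powr (1 / r)"
    using ex_powr_inverse_ge[OF assms(2) A(1)] by blast
  have L0: "0 < L" using L(1) assms(1) by (meson less_trans ln_gt_zero mult_pos_pos one_less_numeral_iff semiring_norm(76))
  \<comment> \<open>The gained factor 1/2 becomes a smaller exponent:
    \<open>exp (L * e) = exp (L / p) / 2\<close>.\<close>
  define e where "e = 1 / p - ln 2 / L"
  have e: "0 < e" "e < 1 / p" using L0 L(1) assms(1) by (auto simp: e_def field_simps)
  have "N (dil (exp (- L)) f) \<le> exp (L * e) * N f" if f: "f \<in> X" for f
  proof -
    have "N (dil (exp (- L)) f) \<le> exp (L * (1 / p)) / 2 * N f"
      using L L0 by (intro le_half_of_scaled_le[OF A(3)[OF L0 f]]) (auto intro: N_nonneg A(2) f)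
    also have "exp (L * (1 / p)) / 2 = exp (L * e)"
      using L0 by (simp add: e_def right_diff_distrib exp_diff)
    finally show ?thesis .
  qed
  then have "ereal (1 / e) \<le> lower_boyd X N" using lower_boyd_ge[OF L0 e(1)] A(2)[OF L0] by blast
  moreover have "p < 1 / e" using e assms(1) by (simp add: field_simps)
  ultimately show ?thesis by (meson less_ereal.simps(1) less_le_trans)
qed

text \<open>The gained factor 1/2 raises the decay exponent from \<open>d\<close> to
  \<open>d + ln 2 / L\<close>. For \<open>d = 0\<close> this already says that the upper index is
  finite.\<close>

lemma upper_boyd_lt_hardy:
  assumes "0 \<le> d" "0 < r" "0 < b" "bounded_on X N (\<lambda>f t. hardy {t<..} b d r f t)"
  shows "\<exists>e>d. upper_boyd X N \<le> ereal (1 / e)"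
proof -
  obtain A where A: "0 \<le> A" "\<And>L f. ln 4 < L \<Longrightarrow> f \<in> X \<Longrightarrow> dil (exp L) f \<in> X"
    "\<And>L f. ln 4 < L \<Longrightarrow> f \<in> X \<Longrightarrow> (L - ln 4) powr (1 / r) * N (dil (exp L) f) \<le> A * exp (- L * d) * N f"
    by (rule dil_bound_H_low[OF assms]) blast
  obtain L where L: "ln 4 < L" "2 * A \<le> (L - ln 4) powr (1 / r)"
    using ex_powr_inverse_ge[OF assms(2) A(1)] by blast
  have L0: "0 < L" using L(1) by (meson less_trans ln_gt_zero one_less_numeral_iff semiring_norm(76))
  define e where "e = d + ln 2 / L"
  have e: "d < e" using L0 by (simp add: e_def)
  have "N (dil (exp L) f) \<le> exp (- L * e) * N f" if f: "f \<in> X" for f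
  proof -
    have "N (dil (exp L) f) \<le> exp (- L * d) / 2 * N f"
      using L by (intro le_half_of_scaled_le[OF A(3)[OF L(1) f]]) (auto intro: N_nonneg A(2) f)
    also have "- L * e = - L * d - ln 2" using L0 by (simp add: e_def distrib_left)
    then have "exp (- L * d) / 2 = exp (- L * e)" by (simp only: exp_diff) simp
    finally show ?thesis .
  qed
  then have "upper_boyd X N \<le> ereal (1 / e)"
    using upper_boyd_le[OF L0, of e] A(2)[OF L(1)] e assms(1) by force
  then show ?thesis using e by blast
qed

lemma upper_boyd_lt:
  assumes "0 < q" "0 < r" "bounded_on X N (H_low q r)"
  shows "upper_boyd X N < q"
proof (cases q)
  case (real q1)
  have "bounded_on X N (\<lambda>f t. hardy {t<..} (r / q1) (1 / q1) r f t)"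
    using assms(3) real by (simp add: H_low_def H_low_fin_eq_hardy[abs_def])
  then obtain e where e: "1 / q1 < e" "upper_boyd X N \<le> ereal (1 / e)"
    using upper_boyd_lt_hardy[of "1 / q1" r "r / q1"] assms(1,2) real by auto
  have "0 < q1" using assms(1) real by simp
  moreover from this have "0 < e" using e(1) by (meson divide_pos_pos less_trans zero_less_one)
  ultimately have "1 / e < q1" using e(1) by (simp add: field_simps)
  then show ?thesis using e(2) real by (auto intro: le_less_trans)
next
  case PInf
  have "bounded_on X N (\<lambda>f t. hardy {t<..} 1 0 r f t)"
    using assms(3) PInf bounded_on_cong[OF H_low_inf_eq_hardy] by (simp add: H_low_def)
  then obtain e where "upper_boyd X N \<le> ereal (1 / e)"
    using upper_boyd_lt_hardy[of 0 r 1] assms(2) by auto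
  then show ?thesis using PInf by (auto intro: le_less_trans)
qed (use assms in auto)

end

theorem theorem2:
  fixes X :: "(real \<Rightarrow> real) set" and N :: "(real \<Rightarrow> real) \<Rightarrow> real"
  assumes "ri_space X N"
  shows "(\<forall>p r. 0 < p \<longrightarrow> 0 < r \<longrightarrow>
            (bounded_on X N (H_up p r) \<longleftrightarrow> ereal p < lower_boyd X N))
       \<and> (\<forall>(q::ereal) r. 0 < q \<longrightarrow> 0 < r \<longrightarrow>
            (bounded_on X N (H_low q r) \<longleftrightarrow> upper_boyd X N < q))
       \<and> (\<forall>p. 0 < p \<longrightarrow> ereal p < lower_boyd X N \<longrightarrow> bounded_on X N (H_up_inf p))
       \<and> (\<forall>q. 0 < q \<longrightarrow> upper_boyd X N < ereal q \<longrightarrow> bounded_on X N (H_low_sup q))"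
proof -
  interpret ri X N using assms by unfold_locales
  show ?thesis
    using bounded_on_H_up lower_boyd_gt bounded_on_H_low upper_boyd_lt bounded_on_H_up_inf
      bounded_on_H_low_sup by blast
qed

end
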